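(* Let $q$ be a real number with $0<|q|<1$. Let $\mathcal{O}(\mathbb{R}P^2_q)$ be the unital complex $*$-algebra of the quantum real projective plane, i.e. the fixed-point subalgebra of $\mathcal{O}(S^2_{q,1})$ under the antipodal automorphism $K\mapsto -K$, $L\mapsto -L$, and let $P=K^2$, $R=L^2$, $T=KL$ be its generators. Let $\rho$ be the $*$-representation of $\mathcal{O}(\mathbb{R}P^2_q)$ by bounded operators on a Hilbert space $H$ with orthonormal basis $\{e_k\}_{k\in\mathbb{N}}$ determined by $$\rho(P)e_k=q^{4k}e_k,\qquad \rho(T)e_k=q^{2(k-1)}\sqrt{1-q^{4k}}\,e_{k-1},\qquad \rho(R)e_k=\sqrt{(1-q^{4k})(1-q^{4(k-1)})}\,e_{k-2}.$$ Then: (i) The representation $\rho$ is faithful (injective) on $\mathcal{O}(\mathbb{R}P^2_q)$. (ii) The set $$\{P^kR^l \mid k,l\in\mathbb{N}\}\cup\{P^k (R^* )^l \mid k\in\mathbb{N},\ l\in\mathbb{N}\setminus\{0\}\}\cup\{P^kR^lT \mid k,l\in\mathbb{N}\}\cup\{P^k(R^* )^lT^* \mid k,l\in\mathbb{N}\}$$ is a basis of the complex vector space $\mathcal{O}(\mathbb{R}P^2_q)$.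
   Context: Here $\mathbb{N}=\{0,1,2,\dots\}$. All algebras are unital associative algebras over $\mathbb{C}$. The coordinate algebra $\mathcal{O}(S^2_{q,1})$ of the Podleś equator quantum sphere is the unital $*$-algebra generated by $K$ and $L$ subject to the relations $$K=K^*,\qquad LK=q^2KL,\qquad L^*L+K^2=1,\qquad LL^*+q^4K^2=1.$$ The antipodal $\mathbb{Z}_2$-action is given by the $*$-automorphism $r_2$ of $\mathcal{O}(S^2_{q,1})$ with $r_2(K)=-K$, $r_2(L)=-L$. The $*$-algebra of the quantum real projective plane is $$\mathcal{O}(\mathbb{R}P^2_q):=\{a\in\mathcal{O}(S^2_{q,1})\mid r_2(a)=a\}.$$ It is generated as a $*$-algebra by $P=K^2$, $R=L^2$, $T=KL$. In the formulas for $\rho$, vectors $e_j$ with $j<0$ are interpreted as $0$ (the corresponding coefficients $\sqrt{1-q^{4k}}$ at $k=0$ and $\sqrt{(1-q^{4k})(1-q^{4(k-1)})}$ at $k=0,1$ are taken to be $0$). *)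

theory Defs
  imports
    "HOL-Analysis.Analysis"
    "HOL-Library.Poly_Mapping"
    "HOL-Algebra.QuotRing"
    "Jordan_Normal_Form.VS_Connect"
begin

section \<open>Free unital star-algebras\<close>

datatype 'a free_monoid = Word (letters: "'a list")

instantiation free_monoid :: (type) monoid_add
begin

definition "0 = Word []"
definition "u + v = Word (letters u @ letters v)"

instance
  by standard (simp_all add: zero_free_monoid_def plus_free_monoid_def)

end

text \<open>A letter \<open>(g, False)\<close> stands for the generator \<open>g\<close> and \<open>(g, True)\<close> for its adjoint \<open>g\<^sup>*\<close>.
  The product of the library on \<open>_ \<Rightarrow>\<^sub>0 complex\<close> is convolution, so the type below is the
  algebra of noncommutative complex polynomials in these letters.\<close>

type_synonym 'g free_star = "('g \<times> bool) free_monoid \<Rightarrow>\<^sub>0 complex"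

definition gen :: "'g \<Rightarrow> 'g free_star" where
  "gen g = Poly_Mapping.single (Word [(g, False)]) 1"

definition scl :: "complex \<Rightarrow> 'g free_star \<Rightarrow> 'g free_star" where
  "scl c p = Poly_Mapping.map ((*) c) p"

definition word_star :: "('g \<times> bool) free_monoid \<Rightarrow> ('g \<times> bool) free_monoid" where
  "word_star w = Word (rev (map (\<lambda>(g, b). (g, \<not> b)) (letters w)))"

definition free_star :: "'g free_star \<Rightarrow> 'g free_star" where
  "free_star p = (\<Sum>w\<in>Poly_Mapping.keys p.
     Poly_Mapping.single (word_star w) (cnj (Poly_Mapping.lookup p w)))"

text \<open>The automorphism of the free star-algebra that sends every generator \<open>g\<close> to \<open>- g\<close>.\<close>

definition free_antipode :: "'g free_star \<Rightarrow> 'g free_star" where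
  "free_antipode p = (\<Sum>w\<in>Poly_Mapping.keys p.
     Poly_Mapping.single w ((- 1) ^ length (letters w) * Poly_Mapping.lookup p w))"

record 'a star_algebra = "(complex, 'a) module" +
  star :: "'a \<Rightarrow> 'a"

definition free_star_algebra :: "'g free_star star_algebra" where
  "free_star_algebra = \<lparr>carrier = UNIV, mult = (*), one = 1, zero = 0, add = (+),
     smult = scl, star = free_star\<rparr>"

text \<open>The operations on cosets follow the pattern of \<^const>\<open>rcoset_mult\<close>; they are the usual
  ones when \<open>I\<close> is a two-sided ideal that is closed under the star.\<close>

definition star_quot :: "'a star_algebra \<Rightarrow> 'a set \<Rightarrow> 'a set star_algebra" where
  "star_quot A I = \<lparr>carrier = carrier (A Quot I), mult = mult (A Quot I), one = one (A Quot I),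
     zero = zero (A Quot I), add = add (A Quot I),
     smult = (\<lambda>c X. \<Union>x\<in>X. I +>\<^bsub>A\<^esub> (c \<odot>\<^bsub>A\<^esub> x)),
     star = (\<lambda>X. \<Union>x\<in>X. I +>\<^bsub>A\<^esub> star A x)\<rparr>"

section \<open>The equator quantum sphere and the quantum real projective plane\<close>

datatype sphere_gen = K_gen | L_gen

definition podles_relations :: "real \<Rightarrow> sphere_gen free_star set" where
  "podles_relations q =
     (let K = gen K_gen; L = gen L_gen; Ks = free_star K; Ls = free_star L; q' = complex_of_real q in
       {K - Ks,
        L * K - scl (q'^2) (K * L),
        Ls * L + K * K - 1,
        L * Ls + scl (q'^4) (K * K) - 1})"

text \<open>Adjoining the adjoints of the relations makes the ideal closed under the star, so that the
  quotient is the star-algebra with this presentation.\<close>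

definition podles_ideal :: "real \<Rightarrow> sphere_gen free_star set" where
  "podles_ideal q =
     Idl\<^bsub>free_star_algebra\<^esub> (podles_relations q \<union> free_star ` podles_relations q)"

definition podles :: "real \<Rightarrow> sphere_gen free_star set star_algebra" where
  "podles q = star_quot free_star_algebra (podles_ideal q)"

definition podles_class :: "real \<Rightarrow> sphere_gen free_star \<Rightarrow> sphere_gen free_star set" where
  "podles_class q p = podles_ideal q +>\<^bsub>free_star_algebra\<^esub> p"

definition podles_K :: "real \<Rightarrow> sphere_gen free_star set" where
  "podles_K q = podles_class q (gen K_gen)"

definition podles_L :: "real \<Rightarrow> sphere_gen free_star set" where
  "podles_L q = podles_class q (gen L_gen)"

definition antipode :: "real \<Rightarrow> sphere_gen free_star set \<Rightarrow> sphere_gen free_star set" where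
  "antipode q X = (\<Union>x\<in>X. podles_class q (free_antipode x))"

definition RP :: "real \<Rightarrow> sphere_gen free_star set star_algebra" where
  "RP q = (podles q)\<lparr>carrier := {a \<in> carrier (podles q). antipode q a = a}\<rparr>"

definition RP_P :: "real \<Rightarrow> sphere_gen free_star set" where
  "RP_P q = podles_K q [^]\<^bsub>podles q\<^esub> (2::nat)"

definition RP_R :: "real \<Rightarrow> sphere_gen free_star set" where
  "RP_R q = podles_L q [^]\<^bsub>podles q\<^esub> (2::nat)"

definition RP_T :: "real \<Rightarrow> sphere_gen free_star set" where
  "RP_T q = podles_K q \<otimes>\<^bsub>podles q\<^esub> podles_L q"

section \<open>Complex Hilbert spaces and star-representations\<close>

class chilbert_space = banach +
  fixes scaleC :: "complex \<Rightarrow> 'a \<Rightarrow> 'a" (infixr \<open>*\<^sub>C\<close> 75)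
    and cinner :: "'a \<Rightarrow> 'a \<Rightarrow> complex"
  assumes scaleC_add_right: "c *\<^sub>C (x + y) = c *\<^sub>C x + c *\<^sub>C y"
    and scaleC_add_left: "(c + d) *\<^sub>C x = c *\<^sub>C x + d *\<^sub>C x"
    and scaleC_scaleC: "c *\<^sub>C d *\<^sub>C x = (c * d) *\<^sub>C x"
    and scaleC_one: "1 *\<^sub>C x = x"
    and scaleR_scaleC: "r *\<^sub>R x = complex_of_real r *\<^sub>C x"
    and cinner_commute: "cinner x y = cnj (cinner y x)"
    and cinner_add_right: "cinner x (y + z) = cinner x y + cinner x z"
    and cinner_scaleC_right: "cinner x (c *\<^sub>C y) = c * cinner x y"
    and cinner_self: "cinner x x = complex_of_real ((norm x)\<^sup>2)"

interpretation cvs: vector_space "scaleC :: complex \<Rightarrow> 'a \<Rightarrow> 'a::chilbert_space"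
  by standard (simp_all add: scaleC_add_right scaleC_add_left scaleC_scaleC scaleC_one)

text \<open>The class is inhabited, e.g. by the complex numbers.\<close>

instantiation complex :: chilbert_space
begin

definition "scaleC_complex = ((*) :: complex \<Rightarrow> complex \<Rightarrow> complex)"
definition "cinner_complex x y = cnj x * y" for x y :: complex

instance
  by standard (simp_all add: scaleC_complex_def cinner_complex_def algebra_simps scaleR_conv_of_real
    complex_norm_square del: of_real_power)

end

definition orthonormal_basis :: "('i \<Rightarrow> 'h::chilbert_space) \<Rightarrow> bool" where
  "orthonormal_basis e \<longleftrightarrow>
     (\<forall>i j. cinner (e i) (e j) = (if i = j then 1 else 0)) \<and>
     closure (cvs.span (range e)) = UNIV"

definition bounded_clinear :: "('h::chilbert_space \<Rightarrow> 'h) \<Rightarrow> bool" where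
  "bounded_clinear f \<longleftrightarrow> bounded_linear f \<and> (\<forall>c x. f (c *\<^sub>C x) = c *\<^sub>C f x)"

text \<open>A unital representation by bounded operators; the last clause says that \<open>\<rho> (a\<^sup>*)\<close> is
  the adjoint of \<open>\<rho> a\<close>.\<close>

definition star_rep :: "'a star_algebra \<Rightarrow> ('a \<Rightarrow> 'h::chilbert_space \<Rightarrow> 'h) \<Rightarrow> bool" where
  "star_rep A \<rho> \<longleftrightarrow>
     (\<forall>a\<in>carrier A. bounded_clinear (\<rho> a)) \<and>
     (\<forall>x. \<rho> \<one>\<^bsub>A\<^esub> x = x) \<and>
     (\<forall>a\<in>carrier A. \<forall>b\<in>carrier A. \<forall>x. \<rho> (a \<oplus>\<^bsub>A\<^esub> b) x = \<rho> a x + \<rho> b x) \<and>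
     (\<forall>a\<in>carrier A. \<forall>b\<in>carrier A. \<forall>x. \<rho> (a \<otimes>\<^bsub>A\<^esub> b) x = \<rho> a (\<rho> b x)) \<and>
     (\<forall>c. \<forall>a\<in>carrier A. \<forall>x. \<rho> (c \<odot>\<^bsub>A\<^esub> a) x = c *\<^sub>C \<rho> a x) \<and>
     (\<forall>a\<in>carrier A. \<forall>x y. cinner (\<rho> (star A a) x) y = cinner x (\<rho> a y))"

section \<open>The constructions are well defined\<close>

lemma poly_mapping_single_induct [case_names single add]:
  fixes p :: "'a \<Rightarrow>\<^sub>0 'b::comm_monoid_add"
  assumes single: "\<And>w c. P (Poly_Mapping.single w c)"
    and add: "\<And>p q. P p \<Longrightarrow> P q \<Longrightarrow> P (p + q)"
  shows "P p"
proof -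
  have "p = (\<Sum>w\<in>Poly_Mapping.keys p. Poly_Mapping.single w (Poly_Mapping.lookup p w))"
    by (rule poly_mapping_eqI)
      (auto simp: lookup_sum lookup_single when_def in_keys_iff)
  moreover have "P (\<Sum>w\<in>A. Poly_Mapping.single w (Poly_Mapping.lookup p w))" if "finite A" for A
    using that
  proof induction
    case empty
    show ?case using single[of undefined 0] by simp
  qed (simp add: single add)
  ultimately show ?thesis by (metis finite_keys)
qed

lemma lookup_scl [simp]: "Poly_Mapping.lookup (scl c p) w = c * Poly_Mapping.lookup p w"
  by (simp add: scl_def map.rep_eq when_def)

lemma scl_single [simp]: "scl c (Poly_Mapping.single w d) = Poly_Mapping.single w (c * d)"
  by (rule poly_mapping_eqI) (simp add: lookup_single when_def)

lemma scl_add: "scl c (p + r) = scl c p + scl c r"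
  by (rule poly_mapping_eqI) (simp add: lookup_add algebra_simps)

lemma scl_conv_times: "scl c p = Poly_Mapping.single 0 c * p"
  by (induction p rule: poly_mapping_single_induct) (simp_all add: mult_single scl_add distrib_left)

lemma word_star_word_star [simp]: "word_star (word_star w) = w"
  by (cases w) (auto simp: word_star_def rev_map comp_def case_prod_beta)

lemma word_star_plus: "word_star (u + v) = word_star v + word_star u"
  by (simp add: word_star_def plus_free_monoid_def)

lemma lookup_free_star: "Poly_Mapping.lookup (free_star p) w = cnj (Poly_Mapping.lookup p (word_star w))"
proof -
  have "word_star u = w \<longleftrightarrow> u = word_star w" for u
    by auto
  then show ?thesis
    by (auto simp: free_star_def lookup_sum lookup_single when_def in_keys_iff)
qed

lemma lookup_free_antipode:
  "Poly_Mapping.lookup (free_antipode p) w = (- 1) ^ length (letters w) * Poly_Mapping.lookup p w"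
  by (auto simp: free_antipode_def lookup_sum lookup_single when_def in_keys_iff)

lemma free_star_single: "free_star (Poly_Mapping.single w c) = Poly_Mapping.single (word_star w) (cnj c)"
  by (rule poly_mapping_eqI) (auto simp: lookup_free_star lookup_single when_def)

lemma free_antipode_single:
  "free_antipode (Poly_Mapping.single w c) = Poly_Mapping.single w ((- 1) ^ length (letters w) * c)"
  by (rule poly_mapping_eqI) (auto simp: lookup_free_antipode lookup_single when_def)

lemma free_star_add: "free_star (p + r) = free_star p + free_star r"
  by (rule poly_mapping_eqI) (simp add: lookup_free_star lookup_add)

lemma free_antipode_add: "free_antipode (p + r) = free_antipode p + free_antipode r"
  by (rule poly_mapping_eqI) (simp add: lookup_free_antipode lookup_add algebra_simps)

lemma free_star_uminus: "free_star (- p) = - free_star p"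
  by (rule poly_mapping_eqI) (simp add: lookup_free_star)

lemma free_antipode_uminus: "free_antipode (- p) = - free_antipode p"
  by (rule poly_mapping_eqI) (simp add: lookup_free_antipode)

lemma free_star_mult: "free_star (p * r) = free_star r * free_star p"
proof (induction p rule: poly_mapping_single_induct)
  case (single w c)
  show ?case
    by (induction r rule: poly_mapping_single_induct)
      (simp_all add: mult_single free_star_single word_star_plus mult.commute free_star_add algebra_simps)
qed (simp add: distrib_left distrib_right free_star_add)

lemma free_antipode_mult: "free_antipode (p * r) = free_antipode p * free_antipode r"
proof (induction p rule: poly_mapping_single_induct)
  case (single w c)
  show ?case
    by (induction r rule: poly_mapping_single_induct)
      (simp_all add: mult_single free_antipode_single plus_free_monoid_def power_add mult.commute
        mult.left_commute free_antipode_add algebra_simps)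
qed (simp add: distrib_left distrib_right free_antipode_add)

lemma free_star_free_star [simp]: "free_star (free_star p) = p"
  by (rule poly_mapping_eqI) (simp add: lookup_free_star)

lemma free_antipode_free_star: "free_antipode (free_star p) = free_star (free_antipode p)"
  by (rule poly_mapping_eqI) (simp add: lookup_free_star lookup_free_antipode word_star_def)

lemma free_star_scl: "free_star (scl c p) = scl (cnj c) (free_star p)"
  by (rule poly_mapping_eqI) (simp add: lookup_free_star)

lemma free_antipode_scl: "free_antipode (scl c p) = scl c (free_antipode p)"
  by (rule poly_mapping_eqI) (simp add: lookup_free_antipode)

lemma free_antipode_gen: "free_antipode (gen g) = - gen g"
  by (simp add: gen_def free_antipode_single single_uminus)

lemma free_antipode_one: "free_antipode 1 = 1"
  by (metis free_antipode_single single_one zero_free_monoid_def free_monoid.sel list.size(3) power_0 mult_1)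

interpretation free_alg: ring "free_star_algebra :: 'g free_star star_algebra"
  by (unfold_locales)
    (auto simp: free_star_algebra_def algebra_simps Units_def intro: exI[of _ "- _"] add.left_inverse add.right_inverse)

lemma free_star_algebra_simps [simp]:
  "carrier free_star_algebra = UNIV" "mult free_star_algebra = (*)" "one free_star_algebra = 1"
  "zero free_star_algebra = 0" "add free_star_algebra = (+)" "smult free_star_algebra = scl"
  "star free_star_algebra = free_star"
  by (simp_all add: free_star_algebra_def)

lemma a_inv_free_star_algebra [simp]: "\<ominus>\<^bsub>free_star_algebra\<^esub> p = - p"
  by (rule free_alg.minus_equality) simp_all

lemma ideal_free_star_algebraI:
  assumes "0 \<in> J" "\<And>p r. p \<in> J \<Longrightarrow> r \<in> J \<Longrightarrow> p + r \<in> J" "\<And>p. p \<in> J \<Longrightarrow> - p \<in> J"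
    "\<And>p r. p \<in> J \<Longrightarrow> r * p \<in> J" "\<And>p r. p \<in> J \<Longrightarrow> p * r \<in> J"
  shows "ideal J (free_star_algebra :: 'g free_star star_algebra)"
proof (rule idealI)
  show "subgroup J (add_monoid (free_star_algebra :: 'g free_star star_algebra))"
    using assms a_inv_free_star_algebra[where 'a='g]
    by (intro subgroup.intro) (auto simp: a_inv_def)
qed (use assms free_alg.ring_axioms in auto)

lemma ideal_podles_ideal: "ideal (podles_ideal q) free_star_algebra"
  unfolding podles_ideal_def by (rule free_alg.genideal_ideal) simp

lemma podles_relations_in_ideal:
  "podles_relations q \<subseteq> podles_ideal q" "free_star ` podles_relations q \<subseteq> podles_ideal q"
  using free_alg.genideal_self[of "podles_relations q \<union> free_star ` podles_relations q"]
  by (simp_all add: podles_ideal_def)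

lemma podles_ideal_closed:
  "0 \<in> podles_ideal q"
  "p \<in> podles_ideal q \<Longrightarrow> r \<in> podles_ideal q \<Longrightarrow> p + r \<in> podles_ideal q"
  "p \<in> podles_ideal q \<Longrightarrow> - p \<in> podles_ideal q"
  "p \<in> podles_ideal q \<Longrightarrow> s * p \<in> podles_ideal q"
  "p \<in> podles_ideal q \<Longrightarrow> p * s \<in> podles_ideal q"
proof -
  interpret ideal "podles_ideal q" free_star_algebra
    by (rule ideal_podles_ideal)
  show "0 \<in> podles_ideal q" "p \<in> podles_ideal q \<Longrightarrow> r \<in> podles_ideal q \<Longrightarrow> p + r \<in> podles_ideal q"
    "p \<in> podles_ideal q \<Longrightarrow> - p \<in> podles_ideal q"
    "p \<in> podles_ideal q \<Longrightarrow> s * p \<in> podles_ideal q"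
    "p \<in> podles_ideal q \<Longrightarrow> p * s \<in> podles_ideal q"
    using zero_closed a_closed a_inv_closed I_l_closed I_r_closed
      free_star_algebra_simps a_inv_free_star_algebra by (metis UNIV_I)+
qed

lemma podles_ideal_diff:
  "p \<in> podles_ideal q \<Longrightarrow> r \<in> podles_ideal q \<Longrightarrow> p - r \<in> podles_ideal q"
  using podles_ideal_closed(2)[of p q "- r"] podles_ideal_closed(3) by simp

lemma scl_podles_ideal: "p \<in> podles_ideal q \<Longrightarrow> scl c p \<in> podles_ideal q"
  by (simp add: scl_conv_times podles_ideal_closed)

lemma free_star_podles_ideal:
  assumes "p \<in> podles_ideal q"
  shows "free_star p \<in> podles_ideal q"
proof -
  let ?J = "{p. free_star p \<in> podles_ideal q}"
  have [simp]: "free_star 0 = (0 :: sphere_gen free_star)"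
    by (simp add: free_star_def)
  have "ideal ?J free_star_algebra"
    by (intro ideal_free_star_algebraI)
      (auto simp: free_star_add free_star_uminus free_star_mult intro: podles_ideal_closed)
  moreover have "podles_relations q \<union> free_star ` podles_relations q \<subseteq> ?J"
    using podles_relations_in_ideal[of q] by auto
  ultimately have "podles_ideal q \<subseteq> ?J"
    unfolding podles_ideal_def[of q] by (metis free_alg.genideal_minimal)
  with assms show ?thesis by auto
qed

lemma free_antipode_relations:
  assumes "p \<in> podles_relations q"
  shows "free_antipode p = p \<or> free_antipode p = - p"
proof -
  have "free_antipode (a - b) = free_antipode a - free_antipode b" for a b :: "sphere_gen free_star"
    using free_antipode_add[of a "- b"] by (simp add: free_antipode_uminus)
  with assms show ?thesis
    by (auto simp: podles_relations_def Let_def free_antipode_add free_antipode_mult free_antipode_scl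
        free_antipode_one free_antipode_free_star free_antipode_gen free_star_uminus)
qed

lemma free_antipode_podles_ideal:
  assumes "p \<in> podles_ideal q"
  shows "free_antipode p \<in> podles_ideal q"
proof -
  let ?J = "{p. free_antipode p \<in> podles_ideal q}"
  have [simp]: "free_antipode 0 = (0 :: sphere_gen free_star)"
    by (simp add: free_antipode_def)
  have "ideal ?J free_star_algebra"
    by (intro ideal_free_star_algebraI)
      (auto simp: free_antipode_add free_antipode_uminus free_antipode_mult intro: podles_ideal_closed)
  moreover have *: "podles_relations q \<subseteq> ?J"
    using podles_relations_in_ideal(1)[of q] free_antipode_relations podles_ideal_closed(3)
    by fastforce
  moreover have "free_star ` podles_relations q \<subseteq> ?J"
    using * free_star_podles_ideal by (auto simp: free_antipode_free_star)
  ultimately have "podles_ideal q \<subseteq> ?J"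
    unfolding podles_ideal_def[of q] by (metis free_alg.genideal_minimal Un_least)
  with assms show ?thesis by auto
qed

lemma mem_podles_class: "x \<in> podles_class q p \<longleftrightarrow> x - p \<in> podles_ideal q"
proof -
  have "podles_class q p = (\<lambda>h. h + p) ` podles_ideal q"
    by (auto simp: podles_class_def a_r_coset_def')
  moreover have "x = (x - p) + p"
    by simp
  ultimately show ?thesis
    by (metis (no_types, lifting) add_diff_cancel_right' image_iff)
qed

lemma podles_class_eq_iff: "podles_class q p = podles_class q r \<longleftrightarrow> p - r \<in> podles_ideal q"
proof
  assume "podles_class q p = podles_class q r"
  then show "p - r \<in> podles_ideal q"
    using mem_podles_class[of p q p] mem_podles_class[of p q r] podles_ideal_closed(1)
    by (metis diff_self)
next
  assume *: "p - r \<in> podles_ideal q"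
  have "x - p \<in> podles_ideal q \<longleftrightarrow> x - r \<in> podles_ideal q" for x
  proof
    assume "x - p \<in> podles_ideal q"
    from podles_ideal_closed(2)[OF this *] show "x - r \<in> podles_ideal q" by simp
  next
    assume "x - r \<in> podles_ideal q"
    from podles_ideal_diff[OF this *] show "x - p \<in> podles_ideal q" by simp
  qed
  then show "podles_class q p = podles_class q r"
    by (simp only: mem_podles_class set_eq_iff) simp
qed

lemma UN_podles_class:
  assumes "\<And>x. x - p \<in> podles_ideal q \<Longrightarrow> f x - f p \<in> podles_ideal q"
  shows "(\<Union>x\<in>podles_class q p. podles_class q (f x)) = podles_class q (f p)"
proof -
  have "p \<in> podles_class q p"
    using podles_ideal_closed(1) by (simp add: mem_podles_class)
  moreover have "podles_class q (f x) = podles_class q (f p)" if "x \<in> podles_class q p" for x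
    using assms that unfolding podles_class_eq_iff mem_podles_class by blast
  ultimately show ?thesis by blast
qed

lemma carrier_podles: "carrier (podles q) = range (podles_class q)"
  by (auto simp: podles_def star_quot_def FactRing_def A_RCOSETS_def' podles_class_def)

lemma podles_class_in_carrier [simp]: "podles_class q p \<in> carrier (podles q)"
  by (simp add: carrier_podles)

lemma podles_class_ops:
  "\<one>\<^bsub>podles q\<^esub> = podles_class q 1"
  "\<zero>\<^bsub>podles q\<^esub> = podles_class q 0"
  "podles_class q p \<oplus>\<^bsub>podles q\<^esub> podles_class q r = podles_class q (p + r)"
  "podles_class q p \<otimes>\<^bsub>podles q\<^esub> podles_class q r = podles_class q (p * r)"
  "c \<odot>\<^bsub>podles q\<^esub> podles_class q p = podles_class q (scl c p)"
  "star (podles q) (podles_class q p) = podles_class q (free_star p)"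
  "antipode q (podles_class q p) = podles_class q (free_antipode p)"
proof -
  interpret ideal "podles_ideal q" free_star_algebra
    by (rule ideal_podles_ideal)
  show "\<one>\<^bsub>podles q\<^esub> = podles_class q 1"
    by (simp add: podles_def star_quot_def FactRing_def podles_class_def)
  show "\<zero>\<^bsub>podles q\<^esub> = podles_class q 0"
    using mem_podles_class[of _ q 0] by (auto simp: podles_def star_quot_def FactRing_def)
  show "podles_class q p \<oplus>\<^bsub>podles q\<^esub> podles_class q r = podles_class q (p + r)"
    using a_rcos_sum[of p r] by (simp add: podles_def star_quot_def FactRing_def podles_class_def)
  show "podles_class q p \<otimes>\<^bsub>podles q\<^esub> podles_class q r = podles_class q (p * r)"
    using rcoset_mult_add[of p r] by (simp add: podles_def star_quot_def FactRing_def podles_class_def)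
  have scl_diff: "scl c x - scl c p = scl c (x - p)" for x
    by (simp add: scl_conv_times algebra_simps)
  show "c \<odot>\<^bsub>podles q\<^esub> podles_class q p = podles_class q (scl c p)"
    using UN_podles_class[of p q "scl c"] scl_podles_ideal
    by (simp add: scl_diff podles_def star_quot_def podles_class_def)
  have star_diff: "free_star x - free_star p = free_star (x - p)" for x :: "sphere_gen free_star"
    using free_star_add[of "x - p" p] by simp
  show "star (podles q) (podles_class q p) = podles_class q (free_star p)"
    using UN_podles_class[of p q free_star] free_star_podles_ideal
    by (simp add: star_diff podles_def star_quot_def podles_class_def)
  have antipode_diff: "free_antipode x - free_antipode p = free_antipode (x - p)" for x
    using free_antipode_add[of "x - p" p] by simp
  show "antipode q (podles_class q p) = podles_class q (free_antipode p)"
    using UN_podles_class[of p q free_antipode] free_antipode_podles_ideal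
    by (simp add: antipode_diff antipode_def)
qed

lemma podles_presentation:
  "star (podles q) (podles_K q) = podles_K q"
  "podles_L q \<otimes>\<^bsub>podles q\<^esub> podles_K q
     = (complex_of_real q)\<^sup>2 \<odot>\<^bsub>podles q\<^esub> (podles_K q \<otimes>\<^bsub>podles q\<^esub> podles_L q)"
  "star (podles q) (podles_L q) \<otimes>\<^bsub>podles q\<^esub> podles_L q
     \<oplus>\<^bsub>podles q\<^esub> podles_K q \<otimes>\<^bsub>podles q\<^esub> podles_K q = \<one>\<^bsub>podles q\<^esub>"
  "podles_L q \<otimes>\<^bsub>podles q\<^esub> star (podles q) (podles_L q)
     \<oplus>\<^bsub>podles q\<^esub> (complex_of_real q)^4 \<odot>\<^bsub>podles q\<^esub> (podles_K q \<otimes>\<^bsub>podles q\<^esub> podles_K q)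
     = \<one>\<^bsub>podles q\<^esub>"
proof -
  have rel:
    "gen K_gen - free_star (gen K_gen) \<in> podles_ideal q"
    "gen L_gen * gen K_gen - scl ((complex_of_real q)\<^sup>2) (gen K_gen * gen L_gen) \<in> podles_ideal q"
    "free_star (gen L_gen) * gen L_gen + gen K_gen * gen K_gen - 1 \<in> podles_ideal q"
    "gen L_gen * free_star (gen L_gen) + scl ((complex_of_real q)^4) (gen K_gen * gen K_gen) - 1
       \<in> podles_ideal q"
    using podles_relations_in_ideal(1)[of q]
    unfolding podles_relations_def Let_def insert_subset by blast+
  note simps = podles_K_def podles_L_def podles_class_ops podles_class_eq_iff
  show "star (podles q) (podles_K q) = podles_K q"
    unfolding simps using podles_ideal_closed(3)[OF rel(1)] by (simp only: minus_diff_eq)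
  show "podles_L q \<otimes>\<^bsub>podles q\<^esub> podles_K q
     = (complex_of_real q)\<^sup>2 \<odot>\<^bsub>podles q\<^esub> (podles_K q \<otimes>\<^bsub>podles q\<^esub> podles_L q)"
    unfolding simps by (rule rel)
  show "star (podles q) (podles_L q) \<otimes>\<^bsub>podles q\<^esub> podles_L q
     \<oplus>\<^bsub>podles q\<^esub> podles_K q \<otimes>\<^bsub>podles q\<^esub> podles_K q = \<one>\<^bsub>podles q\<^esub>"
    unfolding simps by (rule rel)
  show "podles_L q \<otimes>\<^bsub>podles q\<^esub> star (podles q) (podles_L q)
     \<oplus>\<^bsub>podles q\<^esub> (complex_of_real q)^4 \<odot>\<^bsub>podles q\<^esub> (podles_K q \<otimes>\<^bsub>podles q\<^esub> podles_K q)
     = \<one>\<^bsub>podles q\<^esub>"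
    unfolding simps by (rule rel)
qed

lemma antipode_gens:
  "antipode q (podles_K q) = (- 1) \<odot>\<^bsub>podles q\<^esub> podles_K q"
  "antipode q (podles_L q) = (- 1) \<odot>\<^bsub>podles q\<^esub> podles_L q"
  by (simp_all add: podles_K_def podles_L_def podles_class_ops free_antipode_gen scl_conv_times
      single_uminus)

lemma ring_podles: "ring (podles q)"
proof (rule ringI)
  show "abelian_group (podles q)"
  proof (rule abelian_groupI)
    show "\<exists>y\<in>carrier (podles q). y \<oplus>\<^bsub>podles q\<^esub> x = \<zero>\<^bsub>podles q\<^esub>" if "x \<in> carrier (podles q)" for x
    proof -
      from that obtain p where "x = podles_class q p"
        by (auto simp: carrier_podles)
      then show ?thesis
        by (intro bexI[of _ "podles_class q (- p)"]) (auto simp: podles_class_ops)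
    qed
  qed (auto simp: carrier_podles podles_class_ops ac_simps)
  show "Group.monoid (podles q)"
    by (rule monoidI) (auto simp: carrier_podles podles_class_ops mult.assoc)
qed (auto simp: carrier_podles podles_class_ops algebra_simps)

lemma vectorspace_podles: "vectorspace class_ring (podles q)"
proof -
  have "Module.module class_ring (podles q)"
  proof (rule moduleI)
    show "cring (class_ring :: complex ring)"
      by (rule class_cring.cring_axioms)
    show "abelian_group (podles q)"
      using ring_podles by (rule ring.is_abelian_group)
  qed (auto simp: carrier_podles podles_class_ops scl_conv_times mult_single single_add
         mult.assoc[symmetric] distrib_left distrib_right)
  then show ?thesis
    by (intro vectorspace.intro class_field.field_axioms)
qed

lemma carrier_RP_iff:
  "podles_class q p \<in> carrier (RP q) \<longleftrightarrow> free_antipode p - p \<in> podles_ideal q"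
  by (simp add: RP_def podles_class_ops podles_class_eq_iff)

lemma vectorspace_RP: "vectorspace class_ring (RP q)"
proof -
  interpret V: vectorspace class_ring "podles q"
    by (rule vectorspace_podles)
  let ?W = "{a \<in> carrier (podles q). antipode q a = a}"
  have "VectorSpace.subspace class_ring ?W (podles q)"
  proof (intro VectorSpace.subspace.intro vectorspace_podles submodule.intro V.module_axioms)
    have "free_antipode 0 = (0 :: sphere_gen free_star)"
      by (simp add: free_antipode_def)
    then show "\<zero>\<^bsub>podles q\<^esub> \<in> ?W"
      by (simp add: podles_class_ops)
    show "v \<oplus>\<^bsub>podles q\<^esub> w \<in> ?W" if "v \<in> ?W" "w \<in> ?W" for v w
    proof -
      from that obtain x y where xy: "v = podles_class q x" "w = podles_class q y"
        by (auto simp: carrier_podles)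
      with that have "podles_class q (free_antipode x) \<oplus>\<^bsub>podles q\<^esub> podles_class q (free_antipode y)
          = podles_class q x \<oplus>\<^bsub>podles q\<^esub> podles_class q y"
        by (simp only: podles_class_ops mem_Collect_eq)
      with xy show ?thesis
        by (simp add: podles_class_ops free_antipode_add)
    qed
    show "c \<odot>\<^bsub>podles q\<^esub> v \<in> ?W" if "v \<in> ?W" for c v
    proof -
      from that obtain x where x: "v = podles_class q x"
        by (auto simp: carrier_podles)
      with that have "c \<odot>\<^bsub>podles q\<^esub> podles_class q (free_antipode x) = c \<odot>\<^bsub>podles q\<^esub> podles_class q x"
        by (simp only: podles_class_ops mem_Collect_eq)
      with x show ?thesis
        by (simp add: podles_class_ops free_antipode_scl)
    qed
  qed auto
  from V.subspace_is_vs[OF this] show ?thesis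
    by (simp add: RP_def)
qed

lemma RP_closed:
  "\<one>\<^bsub>podles q\<^esub> \<in> carrier (RP q)"
  "a \<in> carrier (RP q) \<Longrightarrow> b \<in> carrier (RP q) \<Longrightarrow> a \<otimes>\<^bsub>podles q\<^esub> b \<in> carrier (RP q)"
  "a \<in> carrier (RP q) \<Longrightarrow> star (podles q) a \<in> carrier (RP q)"
proof -
  show "\<one>\<^bsub>podles q\<^esub> \<in> carrier (RP q)"
    by (simp add: RP_def podles_class_ops free_antipode_one)
  show "a \<otimes>\<^bsub>podles q\<^esub> b \<in> carrier (RP q)" if "a \<in> carrier (RP q)" "b \<in> carrier (RP q)"
  proof -
    from that obtain x y where xy: "a = podles_class q x" "b = podles_class q y"
      by (auto simp: RP_def carrier_podles)
    with that have "podles_class q (free_antipode x) \<otimes>\<^bsub>podles q\<^esub> podles_class q (free_antipode y)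
        = podles_class q x \<otimes>\<^bsub>podles q\<^esub> podles_class q y"
      by (simp add: RP_def podles_class_ops(7))
    with xy show ?thesis
      by (simp add: RP_def podles_class_ops free_antipode_mult)
  qed
  show "star (podles q) a \<in> carrier (RP q)" if "a \<in> carrier (RP q)"
  proof -
    from that obtain x where x: "a = podles_class q x"
      by (auto simp: RP_def carrier_podles)
    with that have "star (podles q) (podles_class q (free_antipode x)) = star (podles q) (podles_class q x)"
      by (simp add: RP_def podles_class_ops(7))
    with x show ?thesis
      by (simp add: RP_def podles_class_ops free_antipode_free_star)
  qed
qed

lemma RP_gens_in_carrier:
  "RP_P q \<in> carrier (RP q)" "RP_R q \<in> carrier (RP q)" "RP_T q \<in> carrier (RP q)"
proof -
  have "RP_P q = podles_class q (gen K_gen * gen K_gen)" "RP_R q = podles_class q (gen L_gen * gen L_gen)"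
    "RP_T q = podles_class q (gen K_gen * gen L_gen)"
    by (simp_all add: RP_P_def RP_R_def RP_T_def podles_K_def podles_L_def podles_class_ops
        nat_pow_def numeral_2_eq_2)
  then show "RP_P q \<in> carrier (RP q)" "RP_R q \<in> carrier (RP q)" "RP_T q \<in> carrier (RP q)"
    by (simp_all add: RP_def podles_class_ops free_antipode_mult free_antipode_gen)
qed

end

theory Submission
  imports Defs
begin

text \<open>The relations allow every word in \<open>K\<close>, \<open>L\<close>, \<open>L\<^sup>*\<close> to be brought into a combination of the normal forms
  \<open>K\<^sup>i L\<^sup>d\<close> with \<open>d \<in> \<int>\<close>, where a negative power of \<open>L\<close> stands for a power of \<open>L\<^sup>*\<close>. Each rewriting
  step keeps the parity of the length of words, so the elements fixed by the antipodal
  automorphism are the combinations of normal forms with \<open>i + d\<close> even. Up to nonzero factors,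
  these are the monomials \<open>P\<^sup>k R\<^sup>l\<close>, \<open>P\<^sup>k (R\<^sup>*)\<^sup>l\<close>, \<open>P\<^sup>k R\<^sup>l T\<close>, \<open>P\<^sup>k (R\<^sup>*)\<^sup>l T\<^sup>*\<close>, one for each pair
  \<open>(k, d)\<close>. So the monomials span (\<open>span_RP_monomial\<close>).

  In a representation where \<open>P\<close> is diagonal with eigenvalues \<open>q\<^sup>4\<^sup>m\<close> and \<open>R\<close>, \<open>T\<close> and their adjoints are
  weighted shifts, the monomial with index \<open>(k, d)\<close> has matrix coefficients on one diagonal only,
  which is determined by \<open>d\<close>, and these are \<open>(q\<^sup>4\<^sup>m)\<^sup>k\<close> times a nonzero weight independent of \<open>k\<close>.
  A combination that acts as zero therefore yields, for each \<open>d\<close>, a polynomial that vanishes at the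
  infinitely many points \<open>q\<^sup>4\<^sup>m\<close>; hence all coefficients are zero
  (\<open>lincomb_RP_monomial_annihilating\<close>).

  This is used twice. For the given representation on the Hilbert space, together with the spanning
  property, it is faithfulness. For linear independence some representation is needed whose
  existence is not an assumption; \<open>formal_action\<close> is such a representation, on formal power
  series.\<close>

section \<open>Calculating modulo the relations of the sphere\<close>

interpretation fs: vector_space "scl :: complex \<Rightarrow> 'g free_star \<Rightarrow> 'g free_star"
  by standard (simp_all add: poly_mapping_eq_iff fun_eq_iff lookup_add algebra_simps)

lemma scl_mult_left: "scl c p * r = scl c (p * r)"
  by (simp add: scl_conv_times mult.assoc)

text \<open>Scalars are the multiples of the empty word, and these are central.\<close>

lemma scl_mult_right: "p * scl c r = scl c (p * r)"
proof -
  have "p * Poly_Mapping.single 0 c = Poly_Mapping.single 0 c * p"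
    by (induction p rule: poly_mapping_single_induct) (simp_all add: mult_single algebra_simps)
  then show ?thesis
    by (simp add: scl_conv_times flip: mult.assoc)
qed

lemmas scl_mult = scl_mult_left scl_mult_right

text \<open>The next two rules allow rewriting modulo the ideal inside products and scalar multiples,
  so that calculations in the quotient are done with representatives in the free algebra.\<close>

lemma podles_class_mult_cong:
  "podles_class q p = podles_class q p' \<Longrightarrow> podles_class q r = podles_class q r' \<Longrightarrow>
    podles_class q (p * r) = podles_class q (p' * r')"
  by (simp flip: podles_class_ops)

lemma podles_class_scl_cong:
  "podles_class q p = podles_class q p' \<Longrightarrow> podles_class q (scl c p) = podles_class q (scl c p')"
  by (simp flip: podles_class_ops)

abbreviation genK :: "sphere_gen free_star" where "genK \<equiv> gen K_gen"
abbreviation genL :: "sphere_gen free_star" where "genL \<equiv> gen L_gen"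
abbreviation genL' :: "sphere_gen free_star" where "genL' \<equiv> free_star (gen L_gen)"

text \<open>The last equation comes from taking adjoints in \<open>L K = q\<^sup>2 K L\<close>; the ideal is closed under
  the star, so the star acts on classes.\<close>

lemma podles_class_relations:
  "podles_class q (free_star genK) = podles_class q genK"
  "podles_class q (genL * genK) = podles_class q (scl ((of_real q)\<^sup>2) (genK * genL))"
  "podles_class q (genL' * genL) = podles_class q (1 + scl (-1) (genK ^ 2))"
  "podles_class q (genL * genL') = podles_class q (1 + scl (- (of_real q ^ 4)) (genK ^ 2))"
  "podles_class q (genK * genL') = podles_class q (scl ((of_real q)\<^sup>2) (genL' * genK))"
proof -
  have mem:
    "genK - free_star genK \<in> podles_ideal q"
    "genL * genK - scl ((of_real q)\<^sup>2) (genK * genL) \<in> podles_ideal q"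
    "genL' * genL + genK * genK - 1 \<in> podles_ideal q"
    "genL * genL' + scl ((of_real q)^4) (genK * genK) - 1 \<in> podles_ideal q"
    using podles_relations_in_ideal(1)[of q]
    unfolding podles_relations_def Let_def insert_subset by blast+
  show K: "podles_class q (free_star genK) = podles_class q genK"
    using mem(1) by (metis podles_class_eq_iff)
  show LK: "podles_class q (genL * genK) = podles_class q (scl ((of_real q)\<^sup>2) (genK * genL))"
    using mem(2) by (simp add: podles_class_eq_iff)
  show "podles_class q (genL' * genL) = podles_class q (1 + scl (-1) (genK ^ 2))"
    using mem(3) by (simp add: podles_class_eq_iff power2_eq_square algebra_simps)
  show "podles_class q (genL * genL') = podles_class q (1 + scl (- (of_real q ^ 4)) (genK ^ 2))"
    using mem(4) by (simp add: podles_class_eq_iff power2_eq_square algebra_simps)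
  have "podles_class q (genK * genL') = podles_class q (free_star genK * genL')"
    by (rule podles_class_mult_cong) (simp_all add: K)
  also have "\<dots> = podles_class q (free_star (genL * genK))"
    by (simp add: free_star_mult)
  also have "\<dots> = podles_class q (free_star (scl ((of_real q)\<^sup>2) (genK * genL)))"
    using arg_cong[OF LK, of "star (podles q)"] by (simp only: podles_class_ops)
  also have "\<dots> = podles_class q (scl ((of_real q)\<^sup>2) (genL' * free_star genK))"
    by (simp add: free_star_scl free_star_mult)
  also have "\<dots> = podles_class q (scl ((of_real q)\<^sup>2) (genL' * genK))"
    by (intro podles_class_scl_cong podles_class_mult_cong K refl)
  finally show "podles_class q (genK * genL') = podles_class q (scl ((of_real q)\<^sup>2) (genL' * genK))" .
qed

text \<open>Skew commutation relations \<open>x y = c y x\<close> pass to powers of \<open>y\<close>. For \<open>c \<noteq> 0\<close> they can also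
  be read from right to left, so this one rule serves for powers of \<open>x\<close> as well.\<close>

lemma podles_class_skew_commute_power:
  assumes "podles_class q (x * y) = podles_class q (scl c (y * x))"
  shows "podles_class q (x * y ^ n) = podles_class q (scl (c ^ n) (y ^ n * x))"
proof (induction n)
  case (Suc n)
  have "podles_class q (x * y ^ Suc n) = podles_class q ((x * y) * y ^ n)"
    by (simp add: mult.assoc)
  also have "\<dots> = podles_class q (scl c (y * x) * y ^ n)"
    by (intro podles_class_mult_cong assms refl)
  also have "\<dots> = podles_class q (scl c (y * (x * y ^ n)))"
    by (simp add: scl_mult mult.assoc)
  also have "\<dots> = podles_class q (scl c (y * scl (c ^ n) (y ^ n * x)))"
    by (intro podles_class_scl_cong podles_class_mult_cong Suc.IH refl)
  also have "\<dots> = podles_class q (scl (c ^ Suc n) (y ^ Suc n * x))"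
    by (simp add: scl_mult mult.assoc)
  finally show ?case .
qed simp

lemma podles_class_skew_commute_swap:
  assumes "podles_class q (x * y) = podles_class q (scl c (y * x))" "c \<noteq> 0"
  shows "podles_class q (y * x) = podles_class q (scl (inverse c) (x * y))"
  using podles_class_scl_cong[OF assms(1), of "inverse c"] assms(2) by simp

text \<open>The power \<open>L\<^sup>d\<close> for an integer \<open>d\<close>, with \<open>L\<^sup>*\<close> in the role of the inverse of \<open>L\<close>. In the
  representations below it lowers the index of a basis vector by \<open>d\<close>.\<close>

definition shift_mono :: "int \<Rightarrow> sphere_gen free_star" where
  "shift_mono d = (if d \<ge> 0 then genL ^ nat d else genL' ^ nat (- d))"

lemma podles_class_K_power_commute:
  assumes "q \<noteq> 0"
  shows "\<exists>c. c \<noteq> 0 \<and> podles_class q (shift_mono d * genK ^ i) = podles_class q (scl c (genK ^ i * shift_mono d))"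
proof -
  define c where "c = (complex_of_real q)\<^sup>2"
  have c: "c \<noteq> 0"
    using assms by (simp add: c_def)
  have commute_power: "\<exists>c. c \<noteq> 0 \<and> podles_class q (x ^ n * genK ^ i) = podles_class q (scl c (genK ^ i * x ^ n))"
    if "podles_class q (x * genK) = podles_class q (scl c (genK * x))" "c \<noteq> 0" for x c n
  proof -
    have "podles_class q (genK ^ i * x) = podles_class q (scl (inverse (c ^ i)) (x * genK ^ i))"
      using podles_class_skew_commute_swap[OF podles_class_skew_commute_power[OF that(1)]] that(2) by simp
    from podles_class_skew_commute_power[OF this, of n]
    have "podles_class q (x ^ n * genK ^ i)
      = podles_class q (scl (inverse (inverse (c ^ i) ^ n)) (genK ^ i * x ^ n))"
      by (rule podles_class_skew_commute_swap) (use that(2) in simp)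
    then show ?thesis
      using that(2) by (intro exI[of _ "inverse (inverse (c ^ i) ^ n)"]) simp
  qed
  have L: "podles_class q (genL * genK) = podles_class q (scl c (genK * genL))"
    and L': "podles_class q (genL' * genK) = podles_class q (scl (inverse c) (genK * genL'))"
    using podles_class_relations[of q] podles_class_skew_commute_swap[OF podles_class_relations(5)] c
    by (simp_all add: c_def)
  show ?thesis
    unfolding shift_mono_def using commute_power[OF L c] commute_power[OF L'] c by simp
qed

text \<open>Multiplication by \<open>L\<close> or \<open>L\<^sup>*\<close> on the left moves \<open>d\<close> by one. If a product \<open>L L\<^sup>*\<close> or \<open>L\<^sup>* L\<close> arises,
  the relations turn it into \<open>1 + c K\<^sup>2\<close>; otherwise the constant is \<open>0\<close>. In both cases the
  total degree of every term changes parity.\<close>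

lemma podles_class_L_shift_mono:
  "\<exists>c. podles_class q (genL * shift_mono d)
     = podles_class q (shift_mono (d + 1) + scl c (genK ^ 2 * shift_mono (d + 1)))"
proof (cases "d \<ge> 0")
  case True
  then have "genL * shift_mono d = shift_mono (d + 1)"
    by (simp add: shift_mono_def nat_add_distrib)
  then show ?thesis
    by (intro exI[of _ 0]) simp
next
  case False
  then have d: "shift_mono d = genL' * shift_mono (d + 1)"
  proof -
    have "nat (- d) = Suc (nat (- (d + 1)))" using False by simp
    then show ?thesis using False by (auto simp: shift_mono_def)
  qed
  have "podles_class q ((genL * genL') * shift_mono (d + 1))
    = podles_class q ((1 + scl (- (of_real q ^ 4)) (genK ^ 2)) * shift_mono (d + 1))"
    by (intro podles_class_mult_cong podles_class_relations refl)
  then show ?thesis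
    by (intro exI[of _ "- (of_real q ^ 4)"]) (simp add: d mult.assoc left_diff_distrib scl_mult)
qed

lemma podles_class_L'_shift_mono:
  "\<exists>c. podles_class q (genL' * shift_mono d)
     = podles_class q (shift_mono (d - 1) + scl c (genK ^ 2 * shift_mono (d - 1)))"
proof (cases "d \<le> 0")
  case True
  then have "nat (- (d - 1)) = Suc (nat (- d))" by simp
  then have "genL' * shift_mono d = shift_mono (d - 1)"
    using True by (auto simp: shift_mono_def)
  then show ?thesis
    by (intro exI[of _ 0]) simp
next
  case False
  then have d: "shift_mono d = genL * shift_mono (d - 1)"
  proof -
    have "nat d = Suc (nat (d - 1))" using False by simp
    then show ?thesis using False by (auto simp: shift_mono_def)
  qed
  have "podles_class q ((genL' * genL) * shift_mono (d - 1))
    = podles_class q ((1 + scl (-1) (genK ^ 2)) * shift_mono (d - 1))"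
    by (intro podles_class_mult_cong podles_class_relations refl)
  then show ?thesis
    by (intro exI[of _ "-1"]) (simp add: d mult.assoc left_diff_distrib scl_mult)
qed

section \<open>Normal forms and the even part\<close>

text \<open>The representatives of linear combinations of the normal forms \<open>K\<^sup>i L\<^sup>d\<close> with \<open>i + d\<close> even
  (respectively odd). Since all relations are even, these two spaces are the eigenspaces of the
  antipodal automorphism.\<close>

definition parity_part :: "real \<Rightarrow> bool \<Rightarrow> sphere_gen free_star set" where
  "parity_part q b = fs.span (podles_ideal q \<union> {genK ^ i * shift_mono d | i d. even (int i + d) = b})"

lemma parity_part_cong:
  assumes "podles_class q p = podles_class q r" "r \<in> parity_part q b"
  shows "p \<in> parity_part q b"
proof -
  have "p - r \<in> parity_part q b"
    using assms(1) unfolding parity_part_def podles_class_eq_iff by (intro fs.span_base) simp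
  with assms(2) have "(p - r) + r \<in> parity_part q b"
    unfolding parity_part_def by (intro fs.span_add)
  then show ?thesis by simp
qed

lemma parity_part_mono: "even (int i + d) = b \<Longrightarrow> genK ^ i * shift_mono d \<in> parity_part q b"
  unfolding parity_part_def by (intro fs.span_base) auto

lemma parity_part_mult:
  assumes "\<And>i d. even (int i + d) = b \<Longrightarrow> g * (genK ^ i * shift_mono d) \<in> parity_part q b'"
    and "p \<in> parity_part q b"
  shows "g * p \<in> parity_part q b'"
  using assms(2) unfolding parity_part_def[of q b]
proof (induction rule: fs.span_induct_alt)
  case base
  show ?case by (simp add: parity_part_def fs.span_zero)
next
  case (step c x y)
  from step(1) have "g * x \<in> parity_part q b'"
  proof
    assume "x \<in> podles_ideal q"
    then show ?thesis
      unfolding parity_part_def by (intro fs.span_base) (simp add: podles_ideal_closed)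
  qed (use assms(1) in auto)
  with step(2) show ?case
    unfolding parity_part_def distrib_left scl_mult by (intro fs.span_add fs.span_scale)
qed

text \<open>Common to \<open>g = L\<close> (with \<open>s = 1\<close>) and \<open>g = L\<^sup>*\<close> (with \<open>s = - 1\<close>): move \<open>g\<close> past \<open>K\<^sup>i\<close> and absorb it
  into \<open>L\<^sup>d\<close>.\<close>

lemma parity_part_shift:
  assumes "q \<noteq> 0" "\<And>d. \<exists>c. podles_class q (g * shift_mono d)
      = podles_class q (shift_mono (d + s) + scl c (genK ^ 2 * shift_mono (d + s)))"
    and "odd s" "\<And>i. \<exists>c. podles_class q (g * genK ^ i) = podles_class q (scl c (genK ^ i * g))"
    and "p \<in> parity_part q b"
  shows "g * p \<in> parity_part q (\<not> b)"
proof (rule parity_part_mult[OF _ assms(5)])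
  fix i d assume id: "even (int i + d) = b"
  from assms(2) obtain c where c: "podles_class q (g * shift_mono d)
      = podles_class q (shift_mono (d + s) + scl c (genK ^ 2 * shift_mono (d + s)))" by blast
  from assms(4) obtain c' where c': "podles_class q (g * genK ^ i) = podles_class q (scl c' (genK ^ i * g))"
    by blast
  have "podles_class q (g * (genK ^ i * shift_mono d)) = podles_class q ((g * genK ^ i) * shift_mono d)"
    by (simp add: mult.assoc)
  also have "\<dots> = podles_class q (scl c' (genK ^ i * g) * shift_mono d)"
    by (intro podles_class_mult_cong c' refl)
  also have "\<dots> = podles_class q (scl c' (genK ^ i * (g * shift_mono d)))"
    by (simp add: scl_mult mult.assoc)
  also have "\<dots> = podles_class q (scl c' (genK ^ i * (shift_mono (d + s) + scl c (genK ^ 2 * shift_mono (d + s)))))"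
    by (intro podles_class_scl_cong podles_class_mult_cong c refl)
  also have "\<dots> = podles_class q (scl c' (genK ^ i * shift_mono (d + s))
      + scl (c' * c) (genK ^ (i + 2) * shift_mono (d + s)))"
    by (simp add: scl_mult scl_add distrib_left power_add[of _ i 2] mult.assoc del: add_2_eq_Suc')
  finally show "g * (genK ^ i * shift_mono d) \<in> parity_part q (\<not> b)"
  proof (rule parity_part_cong)
    have "even (int i + (d + s)) = (\<not> b)" "even (int (i + 2) + (d + s)) = (\<not> b)"
      using id assms(3) by auto
    from this[THEN parity_part_mono]
    show "scl c' (genK ^ i * shift_mono (d + s))
      + scl (c' * c) (genK ^ (i + 2) * shift_mono (d + s)) \<in> parity_part q (\<not> b)"
      unfolding parity_part_def by (intro fs.span_add fs.span_scale)
  qed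
qed

lemma parity_part_letter:
  assumes "q \<noteq> 0" "p \<in> parity_part q b"
  shows "Poly_Mapping.single (Word [(g, a)]) 1 * p \<in> parity_part q (\<not> b)"
proof -
  have K: "genK * p \<in> parity_part q (\<not> b)"
  proof (rule parity_part_mult[OF _ assms(2)])
    fix i d assume "even (int i + d) = b"
    then have "genK ^ Suc i * shift_mono d \<in> parity_part q (\<not> b)"
      by (intro parity_part_mono) auto
    then show "genK * (genK ^ i * shift_mono d) \<in> parity_part q (\<not> b)"
      by (simp add: mult.assoc)
  qed
  have gens: "Poly_Mapping.single (Word [(g, a)]) 1 = (if a then free_star (gen g) else gen g)"
    by (simp add: gen_def free_star_single word_star_def)
  have K': "free_star genK * p \<in> parity_part q (\<not> b)"
    by (rule parity_part_cong[OF podles_class_mult_cong[OF podles_class_relations(1) refl] K])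
  have L: "genL * p \<in> parity_part q (\<not> b)"
  proof (rule parity_part_shift[OF assms(1) podles_class_L_shift_mono _ _ assms(2)])
    show "\<exists>c. podles_class q (genL * genK ^ i) = podles_class q (scl c (genK ^ i * genL))" for i
      using podles_class_K_power_commute[OF assms(1), of 1 i] by (auto simp: shift_mono_def)
  qed auto
  have L': "genL' * p \<in> parity_part q (\<not> b)"
  proof (rule parity_part_shift[where s = "-1", OF assms(1) _ _ _ assms(2)])
    show "\<exists>c. podles_class q (genL' * genK ^ i) = podles_class q (scl c (genK ^ i * genL'))" for i
      using podles_class_K_power_commute[OF assms(1), of "-1" i] by (auto simp: shift_mono_def)
  qed (use podles_class_L'_shift_mono in auto)
  show ?thesis
    unfolding gens using K K' L L' by (cases g) auto
qed

lemma parity_part_word: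
  assumes "q \<noteq> 0"
  shows "Poly_Mapping.single (Word xs) c \<in> parity_part q (even (length xs))"
proof -
  have "Poly_Mapping.single (Word xs) 1 \<in> parity_part q (even (length xs))"
  proof (induction xs)
    case Nil
    have "Poly_Mapping.single (Word []) 1 = genK ^ 0 * shift_mono 0"
      by (simp add: shift_mono_def flip: zero_free_monoid_def)
    then show ?case
      using parity_part_mono[of 0 0 True q] by simp
  next
    case (Cons x xs)
    obtain g a where x: "x = (g, a)" by fastforce
    have "Poly_Mapping.single (Word (x # xs)) (1::complex)
        = Poly_Mapping.single (Word [(g, a)]) 1 * Poly_Mapping.single (Word xs) 1"
      by (simp add: mult_single plus_free_monoid_def x)
    then show ?case
      using parity_part_letter[OF assms Cons.IH] by simp
  qed
  then have "scl c (Poly_Mapping.single (Word xs) 1) \<in> parity_part q (even (length xs))"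
    unfolding parity_part_def by (rule fs.span_scale)
  then show ?thesis by simp
qed

text \<open>A fixed point is congruent to its average over the antipodal action, and averaging leaves only
  words of even length.\<close>

lemma parity_part_RP:
  assumes "q \<noteq> 0" "podles_class q p \<in> carrier (RP q)"
  shows "p \<in> parity_part q True"
proof -
  have sym: "p + free_antipode p \<in> parity_part q True"
  proof (induction p rule: poly_mapping_single_induct)
    case (single w c)
    show ?case
    proof (cases "even (length (letters w))")
      case True
      then show ?thesis
        using parity_part_word[OF assms(1), of "letters w" "c + c"]
        by (simp add: free_antipode_single flip: single_add)
    next
      case False
      then show ?thesis
        by (simp add: free_antipode_single parity_part_def fs.span_zero flip: single_add)
    qed
  next
    case (add p r)
    then have "(p + free_antipode p) + (r + free_antipode r) \<in> parity_part q True"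
      unfolding parity_part_def by (rule fs.span_add)
    then show ?case
      by (simp add: free_antipode_add algebra_simps)
  qed
  show ?thesis
  proof (rule parity_part_cong)
    have "p - scl (1/2) (p + free_antipode p) = scl (- 1/2) (free_antipode p - p)"
      by (rule poly_mapping_eqI) (simp add: lookup_add lookup_minus field_simps)
    then show "podles_class q p = podles_class q (scl (1/2) (p + free_antipode p))"
      using assms(2) unfolding podles_class_eq_iff carrier_RP_iff by (simp only: scl_podles_ideal)
    show "scl (1/2) (p + free_antipode p) \<in> parity_part q True"
      using sym unfolding parity_part_def by (rule fs.span_scale)
  qed
qed

section \<open>The monomials of the projective plane\<close>

lemma podles_class_pow: "podles_class q p [^]\<^bsub>podles q\<^esub> (n::nat) = podles_class q (p ^ n)"
  by (induction n) (simp_all add: nat_pow_def podles_class_ops power_commutes)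

lemma RP_ops [simp]:
  "\<one>\<^bsub>RP q\<^esub> = \<one>\<^bsub>podles q\<^esub>" "\<zero>\<^bsub>RP q\<^esub> = \<zero>\<^bsub>podles q\<^esub>" "x \<oplus>\<^bsub>RP q\<^esub> y = x \<oplus>\<^bsub>podles q\<^esub> y"
  "x \<otimes>\<^bsub>RP q\<^esub> y = x \<otimes>\<^bsub>podles q\<^esub> y" "c \<odot>\<^bsub>RP q\<^esub> x = c \<odot>\<^bsub>podles q\<^esub> x"
  "star (RP q) x = star (podles q) x" "x [^]\<^bsub>RP q\<^esub> (n::nat) = x [^]\<^bsub>podles q\<^esub> n"
  by (simp_all add: RP_def nat_pow_def)

text \<open>In the last equation \<open>T\<^sup>* = L\<^sup>* K\<^sup>*\<close> is simplified by \<open>K\<^sup>* = K\<close>.\<close>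

lemma RP_gens_class:
  "RP_P q = podles_class q (genK ^ 2)"
  "RP_R q = podles_class q (genL ^ 2)"
  "RP_T q = podles_class q (genK * genL)"
  "star (RP q) (RP_R q) = podles_class q (genL' ^ 2)"
  "star (RP q) (RP_T q) = podles_class q (genL' * genK)"
proof -
  show "star (RP q) (RP_T q) = podles_class q (genL' * genK)"
    by (simp add: RP_T_def podles_K_def podles_L_def podles_class_ops free_star_mult)
      (intro podles_class_mult_cong podles_class_relations refl)
qed (simp_all add: RP_P_def RP_R_def RP_T_def podles_K_def podles_L_def podles_class_ops
      podles_class_pow free_star_mult power2_eq_square)

text \<open>The unique element among \<open>R\<^sup>l\<close>, \<open>(R\<^sup>*)\<^sup>l\<close>, \<open>R\<^sup>l T\<close>, \<open>(R\<^sup>*)\<^sup>l T\<^sup>*\<close> that lowers the index of basis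
  vectors by \<open>d\<close>; \<open>R\<close> has degree two and \<open>T\<close> has degree one. The four families of the basis
  are thereby indexed by a single integer.\<close>

definition RP_shift :: "real \<Rightarrow> int \<Rightarrow> sphere_gen free_star set" where
  "RP_shift q d =
     (let R = RP_R q; T = RP_T q; n = nat \<bar>d\<bar> div 2 in
      if even d then (if d \<ge> 0 then R [^]\<^bsub>RP q\<^esub> n else star (RP q) R [^]\<^bsub>RP q\<^esub> n)
      else if d > 0 then R [^]\<^bsub>RP q\<^esub> n \<otimes>\<^bsub>RP q\<^esub> T
      else star (RP q) R [^]\<^bsub>RP q\<^esub> n \<otimes>\<^bsub>RP q\<^esub> star (RP q) T)"

definition RP_monomial :: "real \<Rightarrow> nat \<times> int \<Rightarrow> sphere_gen free_star set" where
  "RP_monomial q = (\<lambda>(k, d). RP_P q [^]\<^bsub>RP q\<^esub> k \<otimes>\<^bsub>RP q\<^esub> RP_shift q d)"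

lemma RP_closed_pow: "a \<in> carrier (RP q) \<Longrightarrow> a [^]\<^bsub>podles q\<^esub> (n::nat) \<in> carrier (RP q)"
  by (induction n) (simp_all add: nat_pow_def RP_closed)

lemma RP_shift_closed: "RP_shift q d \<in> carrier (RP q)"
  by (auto simp: RP_shift_def Let_def intro!: RP_closed RP_closed_pow RP_gens_in_carrier)

lemma RP_monomial_closed: "RP_monomial q i \<in> carrier (RP q)"
  by (auto simp: RP_monomial_def intro!: RP_closed RP_closed_pow RP_gens_in_carrier RP_shift_closed
      split: prod.split)

lemma range_RP_monomial:
  "range (RP_monomial q) =
     {RP_P q [^]\<^bsub>RP q\<^esub> k \<otimes>\<^bsub>RP q\<^esub> RP_R q [^]\<^bsub>RP q\<^esub> l | (k :: nat) (l :: nat). True}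
     \<union> {RP_P q [^]\<^bsub>RP q\<^esub> k \<otimes>\<^bsub>RP q\<^esub> star (RP q) (RP_R q) [^]\<^bsub>RP q\<^esub> l | (k :: nat) (l :: nat). l \<noteq> 0}
     \<union> {RP_P q [^]\<^bsub>RP q\<^esub> k \<otimes>\<^bsub>RP q\<^esub> RP_R q [^]\<^bsub>RP q\<^esub> l \<otimes>\<^bsub>RP q\<^esub> RP_T q | (k :: nat) (l :: nat). True}
     \<union> {RP_P q [^]\<^bsub>RP q\<^esub> k \<otimes>\<^bsub>RP q\<^esub> star (RP q) (RP_R q) [^]\<^bsub>RP q\<^esub> l
          \<otimes>\<^bsub>RP q\<^esub> star (RP q) (RP_T q) | (k :: nat) (l :: nat). True}"
    (is "_ = ?A \<union> ?B \<union> ?C \<union> ?D")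
proof -
  interpret ring "podles q"
    by (rule ring_podles)
  have carr [simp]: "RP_P q \<in> carrier (podles q)" "RP_R q \<in> carrier (podles q)" "RP_T q \<in> carrier (podles q)"
    "star (podles q) (RP_R q) \<in> carrier (podles q)" "star (podles q) (RP_T q) \<in> carrier (podles q)"
    using RP_gens_class[of q] by (simp_all del: podles_class_in_carrier add: podles_class_in_carrier)
  have parity: "(\<exists>l. d = 2 * int l) \<or> (\<exists>l. l \<noteq> 0 \<and> d = - (2 * int l)) \<or>
      (\<exists>l. d = 2 * int l + 1) \<or> (\<exists>l. d = - (2 * int l + 1))" for d
    by presburger
  have A: "RP_monomial q (k, 2 * int l) = RP_P q [^]\<^bsub>RP q\<^esub> k \<otimes>\<^bsub>RP q\<^esub> RP_R q [^]\<^bsub>RP q\<^esub> l" for k l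
  proof -
    have "nat (2 * int l) div 2 = l" by simp
    then show ?thesis by (simp add: RP_monomial_def RP_shift_def)
  qed
  have B: "RP_monomial q (k, - (2 * int l)) = RP_P q [^]\<^bsub>RP q\<^esub> k \<otimes>\<^bsub>RP q\<^esub> star (RP q) (RP_R q) [^]\<^bsub>RP q\<^esub> l"
    if "l \<noteq> 0" for k l
  proof -
    have "nat (2 * int l) div 2 = l" by simp
    with that show ?thesis by (simp add: RP_monomial_def RP_shift_def)
  qed
  have C: "RP_monomial q (k, 2 * int l + 1)
      = RP_P q [^]\<^bsub>RP q\<^esub> k \<otimes>\<^bsub>RP q\<^esub> RP_R q [^]\<^bsub>RP q\<^esub> l \<otimes>\<^bsub>RP q\<^esub> RP_T q" for k l
  proof -
    have "nat \<bar>2 * int l + 1\<bar> div 2 = l" by simp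
    then show ?thesis by (simp add: RP_monomial_def RP_shift_def m_assoc)
  qed
  have D: "RP_monomial q (k, - (2 * int l + 1))
      = RP_P q [^]\<^bsub>RP q\<^esub> k \<otimes>\<^bsub>RP q\<^esub> star (RP q) (RP_R q) [^]\<^bsub>RP q\<^esub> l \<otimes>\<^bsub>RP q\<^esub> star (RP q) (RP_T q)" for k l
  proof -
    have "nat \<bar>- (2 * int l + 1)\<bar> div 2 = l" by simp
    then show ?thesis by (simp add: RP_monomial_def RP_shift_def m_assoc)
  qed
  show ?thesis
  proof (intro subset_antisym subsetI)
    fix x assume "x \<in> range (RP_monomial q)"
    then obtain k d where x: "x = RP_monomial q (k, d)" by auto
    from parity[of d] show "x \<in> ?A \<union> ?B \<union> ?C \<union> ?D"
      unfolding x using A B C D by (elim disjE exE conjE) auto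
  next
    fix x assume "x \<in> ?A \<union> ?B \<union> ?C \<union> ?D"
    then show "x \<in> range (RP_monomial q)"
      by (elim UnE CollectE exE conjE) (metis A rangeI, metis B rangeI, metis C rangeI, metis D rangeI)
  qed
qed

lemma shift_mono_even: "shift_mono (2 * int l) = genL ^ (2 * l)"
proof -
  have "nat (2 * int l) = 2 * l" by simp
  then show ?thesis by (auto simp: shift_mono_def)
qed

text \<open>The even normal form \<open>K\<^sup>i L\<^sup>d\<close> is a multiple of \<open>P\<^sup>k\<close> times the element of degree \<open>d\<close>, where
  \<open>i = 2 k\<close> for even \<open>d\<close>. For odd \<open>d\<close> we have \<open>i = 2 k + 1\<close>: the remaining factor \<open>K\<close> is the one
  inside \<open>T\<close> or \<open>T\<^sup>*\<close>, and moving it to the left produces a power of \<open>q\<close>.\<close>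

lemma podles_class_RP_monomial:
  assumes "q \<noteq> 0" "even (int i + d)"
  shows "\<exists>c. podles_class q (genK ^ i * shift_mono d) = c \<odot>\<^bsub>RP q\<^esub> RP_monomial q (i div 2, d)"
proof (cases "even d")
  case True
  then have "genK ^ i = (genK ^ 2) ^ (i div 2)"
    using assms(2) by (simp flip: power_mult)
  moreover have "RP_shift q d = podles_class q (shift_mono d)"
  proof -
    have "d \<ge> 0 \<Longrightarrow> 2 * (nat d div 2) = nat d" "\<not> d \<ge> 0 \<Longrightarrow> 2 * (nat (- d) div 2) = nat (- d)"
      using True by (simp_all add: even_nat_iff)
    then show ?thesis
      using True unfolding RP_shift_def Let_def RP_gens_class(4) unfolding RP_gens_class(2)
      by (simp add: podles_class_pow shift_mono_def flip: power_mult)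
  qed
  ultimately show ?thesis
    by (intro exI[of _ 1]) (simp add: RP_monomial_def RP_gens_class podles_class_pow podles_class_ops)
next
  case False
  define n where "n = nat \<bar>d\<bar> div 2"
  have n: "nat \<bar>d\<bar> = Suc (2 * n)"
    using False by (auto simp: n_def even_nat_iff)
  have "i = 2 * (i div 2) + 1"
    using False assms(2) by presburger
  then have K: "genK ^ i = (genK ^ 2) ^ (i div 2) * genK"
    by (metis power_add power_mult power_one_right)
  obtain c where c: "c \<noteq> 0" "RP_shift q d = podles_class q (scl c (genK * shift_mono d))"
  proof (cases "d > 0")
    case True
    obtain c where c: "c \<noteq> 0"
      "podles_class q (shift_mono (2 * int n) * genK ^ 1) = podles_class q (scl c (genK ^ 1 * shift_mono (2 * int n)))"
      using podles_class_K_power_commute[OF assms(1)] by blast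
    have "RP_shift q d = podles_class q ((genL ^ 2) ^ n * (genK * genL))"
      using False True unfolding RP_shift_def Let_def RP_gens_class
      by (simp add: podles_class_pow podles_class_ops n_def)
    also have "\<dots> = podles_class q ((shift_mono (2 * int n) * genK ^ 1) * genL)"
      by (simp add: shift_mono_even power_mult mult.assoc)
    also have "\<dots> = podles_class q (scl c (genK ^ 1 * shift_mono (2 * int n)) * genL)"
      by (intro podles_class_mult_cong c refl)
    also have "scl c (genK ^ 1 * shift_mono (2 * int n)) * genL = scl c (genK * shift_mono d)"
      using True n by (simp add: scl_mult shift_mono_even mult.assoc) (simp add: shift_mono_def power_commutes)
    finally show thesis
      using c(1) that by blast
  next
    case d: False
    obtain c where c: "c \<noteq> 0"
      "podles_class q (shift_mono d * genK ^ 1) = podles_class q (scl c (genK ^ 1 * shift_mono d))"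
      using podles_class_K_power_commute[OF assms(1)] by blast
    have "RP_shift q d = podles_class q ((genL' ^ 2) ^ n * (genL' * genK))"
      using False d unfolding RP_shift_def Let_def RP_gens_class(4,5) unfolding RP_gens_class(2,3)
      by (simp add: podles_class_pow podles_class_ops n_def)
    also have "(genL' ^ 2) ^ n * (genL' * genK) = (genL' ^ Suc (2 * n)) * genK"
      by (simp only: power_mult[symmetric] power_Suc2 mult.assoc)
    also have "genL' ^ Suc (2 * n) = shift_mono d"
    proof -
      have "nat (- d) = Suc (2 * n)" using n d by simp
      then show ?thesis using d False by (auto simp: shift_mono_def)
    qed
    finally show thesis
      using c that by simp
  qed
  have "RP_monomial q (i div 2, d) = podles_class q (scl c (genK ^ i * shift_mono d))"
    by (simp add: RP_monomial_def c RP_gens_class podles_class_pow podles_class_ops K scl_mult mult.assoc)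
  then show ?thesis
    using c(1) by (intro exI[of _ "inverse c"]) (simp add: podles_class_ops)
qed

text \<open>Every element of the projective plane is even, hence a combination of even normal forms, and
  these are multiples of the monomials.\<close>

lemma span_RP_monomial:
  assumes "q \<noteq> 0"
  shows "LinearCombinations.module.span class_ring (RP q) (range (RP_monomial q)) = carrier (RP q)"
proof -
  interpret V: vectorspace class_ring "RP q"
    by (rule vectorspace_RP)
  let ?B = "range (RP_monomial q)"
  have B: "?B \<subseteq> carrier (RP q)"
    using RP_monomial_closed by auto
  interpret S: submodule class_ring "V.span ?B" "RP q"
    using B by (rule V.span_is_submodule)
  have "podles_class q p \<in> V.span ?B" if "p \<in> parity_part q True" for p
    using that unfolding parity_part_def
  proof (induction rule: fs.span_induct_alt)
    case base
    show ?case using S.zero_closed by (simp add: podles_class_ops)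
  next
    case (step c x y)
    from step(1) have "podles_class q x \<in> V.span ?B"
    proof
      assume "x \<in> podles_ideal q"
      then have "podles_class q x = podles_class q 0"
        by (simp add: podles_class_eq_iff)
      then show ?thesis using S.zero_closed by (simp add: podles_class_ops)
    next
      assume "x \<in> {genK ^ i * shift_mono d |i d. even (int i + d) = True}"
      then obtain i d where "x = genK ^ i * shift_mono d" "even (int i + d)" by auto
      with podles_class_RP_monomial[OF assms] obtain c
        where c: "podles_class q x = c \<odot>\<^bsub>RP q\<^esub> RP_monomial q (i div 2, d)" by blast
      show ?thesis
        unfolding c by (intro S.smult_closed) (use V.span_mem[OF B] in auto)
    qed
    then have "(c \<odot>\<^bsub>RP q\<^esub> podles_class q x) \<oplus>\<^bsub>RP q\<^esub> podles_class q y \<in> V.span ?B"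
      using step(2) by (intro S.m_closed S.smult_closed) auto
    then show ?case by (simp add: podles_class_ops)
  qed
  moreover have "\<exists>p. x = podles_class q p \<and> p \<in> parity_part q True" if "x \<in> carrier (RP q)" for x
    using that parity_part_RP[OF assms] by (auto simp: RP_def carrier_podles)
  ultimately show ?thesis
    using S.subset by auto
qed

section \<open>Weighted shifts\<close>

text \<open>The operator lowers indices by \<open>d\<close> with nonzero weights, and kills precisely those basis vectors
  whose index would become negative. For \<open>d < 0\<close> it raises indices.\<close>

definition weighted_shift ::
  "(complex \<Rightarrow> 'v \<Rightarrow> 'v::ab_group_add) \<Rightarrow> (nat \<Rightarrow> 'v) \<Rightarrow> int \<Rightarrow> ('v \<Rightarrow> 'v) \<Rightarrow> bool" where
  "weighted_shift sc e d A \<longleftrightarrow>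
     (\<exists>s. \<forall>k. if d \<le> int k then s k \<noteq> 0 \<and> A (e k) = sc (s k) (e (nat (int k - d))) else A (e k) = 0)"

text \<open>The condition on the signs excludes that \<open>B\<close> lowers an index below zero and \<open>A\<close> would have
  raised it again: then the composite kills a basis vector that a weighted shift of degree
  \<open>d + d'\<close> does not kill.\<close>

lemma weighted_shift_comp:
  assumes "vector_space sc" and A: "weighted_shift sc e d A" and B: "weighted_shift sc e d' B"
    and hom: "\<And>c x. A (sc c x) = sc c (A x)" and sign: "d \<ge> 0 \<or> d' \<le> 0"
  shows "weighted_shift sc e (d + d') (\<lambda>x. A (B x))"
proof -
  interpret vector_space sc by fact
  have A0: "A 0 = 0"
    using hom[of 0 0] by simp
  obtain s where s: "\<And>k. if d \<le> int k then s k \<noteq> 0 \<and> A (e k) = sc (s k) (e (nat (int k - d))) else A (e k) = 0"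
    using A unfolding weighted_shift_def by auto
  obtain s' where s': "\<And>k. if d' \<le> int k then s' k \<noteq> 0 \<and> B (e k) = sc (s' k) (e (nat (int k - d'))) else B (e k) = 0"
    using B unfolding weighted_shift_def by auto
  let ?s = "\<lambda>k. s' k * s (nat (int k - d'))"
  have "if d + d' \<le> int k then ?s k \<noteq> 0 \<and> A (B (e k)) = sc (?s k) (e (nat (int k - (d + d'))))
      else A (B (e k)) = 0" for k
  proof (cases "d' \<le> int k")
    case True
    let ?j = "nat (int k - d')"
    have j: "d \<le> int ?j \<longleftrightarrow> d + d' \<le> int k" "int ?j - d = int k - (d + d')"
      using True by auto
    show ?thesis
      using s[of ?j] s'[of k] True unfolding j by (simp add: hom)
  next
    case False
    with sign s'[of k] show ?thesis
      by (simp add: A0)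
  qed
  then show ?thesis
    unfolding weighted_shift_def by (intro exI[of _ ?s]) blast
qed

section \<open>Matrix coefficients separate the monomials\<close>

text \<open>What the Hilbert space representation and the action on formal power series have in common. No
  topology enters: the basis vectors are only tested by the coordinate functionals.\<close>

locale RP_shift_action = vector_space sc
  for sc :: "complex \<Rightarrow> 'v::ab_group_add \<Rightarrow> 'v" +
  fixes q :: real and act :: "sphere_gen free_star set \<Rightarrow> 'v \<Rightarrow> 'v"
    and e :: "nat \<Rightarrow> 'v" and coord :: "nat \<Rightarrow> 'v \<Rightarrow> complex"
  assumes q: "0 < \<bar>q\<bar>" "\<bar>q\<bar> < 1"
    and coord_add: "coord m (x + y) = coord m x + coord m y"
    and coord_scale: "coord m (sc c x) = c * coord m x"
    and coord_e: "coord m (e k) = (if m = k then 1 else 0)"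
    and act_one: "act \<one>\<^bsub>RP q\<^esub> x = x"
    and act_add: "a \<in> carrier (RP q) \<Longrightarrow> b \<in> carrier (RP q) \<Longrightarrow> act (a \<oplus>\<^bsub>RP q\<^esub> b) x = act a x + act b x"
    and act_mult: "a \<in> carrier (RP q) \<Longrightarrow> b \<in> carrier (RP q) \<Longrightarrow> act (a \<otimes>\<^bsub>RP q\<^esub> b) x = act a (act b x)"
    and act_smult: "a \<in> carrier (RP q) \<Longrightarrow> act (c \<odot>\<^bsub>RP q\<^esub> a) x = sc c (act a x)"
    and act_scale: "a \<in> carrier (RP q) \<Longrightarrow> act a (sc c x) = sc c (act a x)"
    and act_P: "act (RP_P q) (e k) = sc (of_real (q ^ (4 * k))) (e k)"
    and act_R: "weighted_shift sc e 2 (act (RP_R q))"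
    and act_R_star: "weighted_shift sc e (- 2) (act (star (RP q) (RP_R q)))"
    and act_T: "weighted_shift sc e 1 (act (RP_T q))"
    and act_T_star: "weighted_shift sc e (- 1) (act (star (RP q) (RP_T q)))"
begin

interpretation V: vectorspace class_ring "RP q"
  by (rule vectorspace_RP)

lemma weighted_shift_mult:
  assumes "a \<in> carrier (RP q)" "b \<in> carrier (RP q)" "weighted_shift sc e d (act a)"
    "weighted_shift sc e d' (act b)" "d \<ge> 0 \<or> d' \<le> 0"
  shows "weighted_shift sc e (d + d') (act (a \<otimes>\<^bsub>RP q\<^esub> b))"
  using weighted_shift_comp[OF vector_space_axioms assms(3,4) act_scale[OF assms(1)] assms(5)]
  unfolding weighted_shift_def by (simp only: act_mult[OF assms(1,2)])

lemma weighted_shift_pow: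
  assumes "a \<in> carrier (RP q)" "weighted_shift sc e d (act a)"
  shows "weighted_shift sc e (int n * d) (act (a [^]\<^bsub>RP q\<^esub> n))"
proof (induction n)
  case 0
  show ?case
    unfolding weighted_shift_def using act_one by (intro exI[of _ "\<lambda>_. 1"]) (simp add: nat_pow_def)
next
  case (Suc n)
  have "int n * d \<ge> 0 \<or> d \<le> 0"
    by (cases "d \<ge> 0") simp_all
  then have "weighted_shift sc e (int n * d + d) (act (a [^]\<^bsub>RP q\<^esub> n \<otimes>\<^bsub>RP q\<^esub> a))"
    using assms Suc.IH by (intro weighted_shift_mult) (simp_all add: RP_closed_pow)
  then show ?case
    by (simp add: nat_pow_def algebra_simps)
qed

lemma weighted_shift_RP_shift: "weighted_shift sc e d (act (RP_shift q d))"
proof -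
  define n where "n = nat \<bar>d\<bar> div 2"
  note closed = RP_gens_in_carrier[of q] RP_closed(3)[OF RP_gens_in_carrier(2)[of q]]
    RP_closed(3)[OF RP_gens_in_carrier(3)[of q]]
  have R: "weighted_shift sc e (int n * 2) (act (RP_R q [^]\<^bsub>RP q\<^esub> n))"
    using closed(2) act_R by (rule weighted_shift_pow)
  have R': "weighted_shift sc e (int n * (- 2)) (act (star (RP q) (RP_R q) [^]\<^bsub>RP q\<^esub> n))"
    using closed(4) act_R_star by (intro weighted_shift_pow) simp_all
  have RT: "weighted_shift sc e (int n * 2 + 1) (act (RP_R q [^]\<^bsub>RP q\<^esub> n \<otimes>\<^bsub>RP q\<^esub> RP_T q))"
    using closed R act_T by (intro weighted_shift_mult) (simp_all add: RP_closed_pow)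
  have RT': "weighted_shift sc e (int n * (- 2) + - 1)
      (act (star (RP q) (RP_R q) [^]\<^bsub>RP q\<^esub> n \<otimes>\<^bsub>RP q\<^esub> star (RP q) (RP_T q)))"
    using closed R' act_T_star by (intro weighted_shift_mult) (simp_all add: RP_closed_pow)
  consider "even d" "d \<ge> 0" | "even d" "d < 0" | "odd d" "d > 0" | "odd d" "d < 0"
    by (metis even_zero linorder_cases not_less)
  then show ?thesis
  proof cases
    case 1
    then have "int n * 2 = d" by (auto simp: n_def)
    with 1 R show ?thesis unfolding RP_shift_def Let_def n_def[symmetric] by (simp del: RP_ops)
  next
    case 2
    then have "int n * (- 2) = d" by (auto simp: n_def)
    with 2 R' show ?thesis unfolding RP_shift_def Let_def n_def[symmetric] by (simp del: RP_ops)
  next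
    case 3
    then have "int n * 2 + 1 = d" unfolding n_def zdiv_int by (simp; presburger)
    with 3 RT show ?thesis unfolding RP_shift_def Let_def n_def[symmetric] by (simp del: RP_ops)
  next
    case 4
    then have "int n * (- 2) + - 1 = d" unfolding n_def zdiv_int by (simp; presburger)
    with 4 RT' show ?thesis unfolding RP_shift_def Let_def n_def[symmetric] by (simp del: RP_ops)
  qed
qed

lemma act_P_pow: "act (RP_P q [^]\<^bsub>RP q\<^esub> k) (e m) = sc (of_real (q ^ (4 * m)) ^ k) (e m)"
proof (induction k)
  case 0
  show ?case using act_one by (simp add: nat_pow_def)
next
  case (Suc k)
  have "act (RP_P q [^]\<^bsub>RP q\<^esub> k \<otimes>\<^bsub>RP q\<^esub> RP_P q) (e m) = act (RP_P q [^]\<^bsub>RP q\<^esub> k) (act (RP_P q) (e m))"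
    by (rule act_mult) (simp_all add: RP_closed_pow RP_gens_in_carrier)
  also have "\<dots> = sc (of_real (q ^ (4 * m))) (act (RP_P q [^]\<^bsub>RP q\<^esub> k) (e m))"
    unfolding act_P by (rule act_scale) (simp add: RP_closed_pow RP_gens_in_carrier)
  finally show ?case
    using Suc.IH by (simp add: nat_pow_def)
qed

lemma coord_zero: "coord m 0 = 0"
  using coord_scale[of m 0 0] by simp

text \<open>The diagonal of a matrix coefficient determines the degree \<open>d\<close> of the monomial, and along
  this diagonal the exponent \<open>k\<close> of \<open>P\<close> appears as the \<open>k\<close>-th power of \<open>q\<^sup>4\<^sup>m\<close>, up to a nonzero
  weight that does not depend on \<open>k\<close>.\<close>

lemma coord_RP_monomial:
  "\<exists>w. \<forall>d m. int m + d \<ge> 0 \<longrightarrow> w d m \<noteq> 0 \<and>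
     (\<forall>k d'. coord m (act (RP_monomial q (k, d')) (e (nat (int m + d))))
       = (if d' = d then w d m * of_real (q ^ (4 * m)) ^ k else 0))"
proof -
  have "\<exists>s. \<forall>k. if d \<le> int k then s k \<noteq> 0 \<and> act (RP_shift q d) (e k) = sc (s k) (e (nat (int k - d)))
      else act (RP_shift q d) (e k) = 0" for d
    using weighted_shift_RP_shift unfolding weighted_shift_def .
  then obtain s where s: "\<And>d k. if d \<le> int k
      then s d k \<noteq> 0 \<and> act (RP_shift q d) (e k) = sc (s d k) (e (nat (int k - d)))
      else act (RP_shift q d) (e k) = 0"
    by metis
  have mono: "act (RP_monomial q (k, d)) x = act (RP_P q [^]\<^bsub>RP q\<^esub> k) (act (RP_shift q d) x)" for k d x
    unfolding RP_monomial_def prod.case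
    by (subst act_mult[symmetric]) (simp_all add: RP_closed_pow RP_gens_in_carrier RP_shift_closed)
  have hom: "act (RP_P q [^]\<^bsub>RP q\<^esub> k) (sc c x) = sc c (act (RP_P q [^]\<^bsub>RP q\<^esub> k) x)" for k :: nat and c x
    by (rule act_scale) (simp add: RP_closed_pow RP_gens_in_carrier)
  have zero: "act (RP_P q [^]\<^bsub>RP q\<^esub> k) 0 = 0" for k :: nat
    using hom[of k 0 0] by simp
  have coord: "coord m (act (RP_monomial q (k, d')) (e (nat (int m + d))))
       = (if d' = d then s d (nat (int m + d)) * of_real (q ^ (4 * m)) ^ k else 0)"
    if md: "int m + d \<ge> 0" for k d d' m
  proof (cases "d' \<le> int m + d")
    case True
    let ?j = "nat (int m + d)"
    have "act (RP_shift q d') (e ?j) = sc (s d' ?j) (e (nat (int m + d - d')))"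
      using s[of d' ?j] True md by simp
    moreover have "m = nat (int m + d - d') \<longleftrightarrow> d' = d"
      using True by auto
    ultimately show ?thesis
      by (auto simp: mono hom act_P_pow coord_scale coord_e simp del: RP_ops)
  next
    case False
    then have "act (RP_shift q d') (e (nat (int m + d))) = 0"
      using s[of d' "nat (int m + d)"] md by simp
    then show ?thesis
      using False by (auto simp: mono zero coord_zero simp del: RP_ops)
  qed
  show ?thesis
  proof (intro exI[of _ "\<lambda>d m. s d (nat (int m + d))"] allI impI conjI)
    show "s d (nat (int m + d)) \<noteq> 0" if "int m + d \<ge> 0" for d m
      using s[of d "nat (int m + d)"] that by simp
  qed (rule coord)
qed

lemma coord_act_lincomb:
  assumes "finite A" "A \<subseteq> carrier (RP q)"
  shows "coord m (act (V.lincomb a A) x) = (\<Sum>v\<in>A. a v * coord m (act v x))"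
  using assms
proof (induction A)
  case empty
  have "act (0 \<odot>\<^bsub>RP q\<^esub> \<one>\<^bsub>RP q\<^esub>) x = 0"
    using RP_closed(1) by (subst act_smult) simp_all
  moreover have "0 \<odot>\<^bsub>RP q\<^esub> \<one>\<^bsub>RP q\<^esub> = \<zero>\<^bsub>RP q\<^esub>"
    using V.lmult_0[of "\<one>\<^bsub>RP q\<^esub>"] RP_closed(1) by simp
  ultimately show ?case
    by (simp add: V.lincomb_def coord_zero)
next
  case (insert v A)
  then have "V.lincomb a (insert v A) = (a v \<odot>\<^bsub>RP q\<^esub> v) \<oplus>\<^bsub>RP q\<^esub> V.lincomb a A"
    using V.lincomb_insert[of A a v] by simp
  moreover have "V.lincomb a A \<in> carrier (RP q)" "a v \<odot>\<^bsub>RP q\<^esub> v \<in> carrier (RP q)"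
    using insert.prems by (auto intro!: V.lincomb_closed V.smult_closed simp del: RP_ops)
  ultimately show ?case
    using insert act_add act_smult by (simp add: coord_add coord_scale)
qed

text \<open>Both parts of the main result rest on this. Restricted to one diagonal, the matrix coefficients
  of a combination of monomials are, up to nonzero weights, the values of one polynomial at the
  points \<open>q\<^sup>4\<^sup>m\<close>; its coefficients are those of the combination. Since \<open>0 < |q| < 1\<close>, there are
  infinitely many such points, so a polynomial that vanishes at all of them is zero.\<close>

lemma lincomb_RP_monomial_annihilating:
  assumes A: "finite A" "A \<subseteq> range (RP_monomial q)"
    and zero: "\<And>k. act (V.lincomb a A) (e k) = 0" and v: "v \<in> A"
  shows "a v = 0"
proof -
  obtain w where w: "\<And>d m. int m + d \<ge> 0 \<Longrightarrow> w d m \<noteq> 0"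
    "\<And>k d d' m. int m + d \<ge> 0 \<Longrightarrow> coord m (act (RP_monomial q (k, d')) (e (nat (int m + d))))
       = (if d' = d then w d m * of_real (q ^ (4 * m)) ^ k else 0)"
    using coord_RP_monomial by metis
  obtain idx where idx: "\<And>u. u \<in> A \<Longrightarrow> RP_monomial q (idx u) = u"
    using A(2) by (metis (mono_tags) f_inv_into_f subset_eq)
  define k d where "k = (\<lambda>u. fst (idx u))" and "d = (\<lambda>u. snd (idx u))"
  have kd: "RP_monomial q (k u, d u) = u" if "u \<in> A" for u
    using idx[OF that] by (simp add: k_def d_def)
  \<comment> \<open>the monomials of \<open>A\<close> that have entries on the same diagonal as \<open>v\<close>\<close>
  define A' where "A' = {u\<in>A. d u = d v}"
  have A': "finite A'" "v \<in> A'" "inj_on k A'"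
  proof -
    show "inj_on k A'"
    proof (rule inj_onI)
      fix x y assume "x \<in> A'" "y \<in> A'" "k x = k y"
      then show "x = y"
        using kd[of x] kd[of y] by (simp add: A'_def)
    qed
  qed (use A v in \<open>auto simp: A'_def\<close>)
  define p where "p = (\<Sum>u\<in>A'. monom (a u) (k u))"
  have root: "poly p (of_real (q ^ (4 * m))) = 0" if "int m + d v \<ge> 0" for m
  proof -
    have AC: "A \<subseteq> carrier (RP q)"
      using A(2) RP_monomial_closed by auto
    let ?x = "e (nat (int m + d v))"
    have "0 = coord m (act (V.lincomb a A) ?x)"
      by (simp add: zero coord_zero)
    also have "\<dots> = (\<Sum>u\<in>A. a u * coord m (act u ?x))"
      using A(1) AC by (rule coord_act_lincomb)
    also have "\<dots> = (\<Sum>u\<in>A. if d u = d v then w (d v) m * (a u * of_real (q ^ (4 * m)) ^ k u) else 0)"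
    proof (rule sum.cong[OF refl])
      fix u assume "u \<in> A"
      then show "a u * coord m (act u ?x)
        = (if d u = d v then w (d v) m * (a u * of_real (q ^ (4 * m)) ^ k u) else 0)"
        using w(2)[OF that, of "k u" "d u"] kd by simp
    qed
    also have "\<dots> = (\<Sum>u\<in>A'. w (d v) m * (a u * of_real (q ^ (4 * m)) ^ k u))"
      unfolding A'_def using A(1) by (rule sum.inter_filter[symmetric])
    also have "\<dots> = w (d v) m * poly p (of_real (q ^ (4 * m)))"
      by (simp add: p_def poly_sum poly_monom sum_distrib_left)
    finally show ?thesis
      using w(1)[OF that] by simp
  qed
  have inj: "inj (\<lambda>m. complex_of_real (q ^ (4 * m)))"
  proof (rule linorder_injI)
    fix m n :: nat assume "m < n"
    then have "\<bar>q\<bar> ^ (4 * n) < \<bar>q\<bar> ^ (4 * m)"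
      using q by (intro power_strict_decreasing) auto
    then show "complex_of_real (q ^ (4 * m)) \<noteq> complex_of_real (q ^ (4 * n))"
      by (metis less_irrefl of_real_eq_iff power_abs)
  qed
  have "infinite ((\<lambda>m. complex_of_real (q ^ (4 * m))) ` {nat (- d v)..})"
    using finite_imageD[OF _ inj_on_subset[OF inj]] infinite_Ici by blast
  moreover have "(\<lambda>m. complex_of_real (q ^ (4 * m))) ` {nat (- d v)..} \<subseteq> {z. poly p z = 0}"
    using root by auto
  ultimately have "p = 0"
    using poly_roots_finite finite_subset by blast
  then have "0 = coeff p (k v)"
    by simp
  also have "\<dots> = (\<Sum>u\<in>A'. if u = v then a u else 0)"
    unfolding p_def coeff_sum coeff_monom using A' by (intro sum.cong refl) (auto dest: inj_onD)
  also have "\<dots> = a v"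
    using A' by simp
  finally show "a v = 0" by simp
qed

end

section \<open>An action on formal power series\<close>

text \<open>Rescaling the basis vectors of the Hilbert space removes the square roots: on power series,
  \<open>L\<^sup>*\<close> is multiplication by \<open>X\<close>, \<open>L\<close> is the operator \<open>X\<^sup>k \<mapsto> (1 - q\<^sup>4\<^sup>k) X\<^sup>k\<^sup>-\<^sup>1\<close>, and \<open>K\<close> is
  diagonal. This exists without any Hilbert space at hand, and it is compatible with the
  relations, which is all that linear independence requires.\<close>

fun formal_letter :: "real \<Rightarrow> sphere_gen \<times> bool \<Rightarrow> complex fps \<Rightarrow> complex fps" where
  "formal_letter q (K_gen, b) f = Abs_fps (\<lambda>n. of_real (q ^ (2 * n)) * fps_nth f n)"
| "formal_letter q (L_gen, False) f = Abs_fps (\<lambda>n. of_real (1 - q ^ (4 * (n + 1))) * fps_nth f (n + 1))"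
| "formal_letter q (L_gen, True) f = fps_X * f"

definition formal_word :: "real \<Rightarrow> (sphere_gen \<times> bool) free_monoid \<Rightarrow> complex fps \<Rightarrow> complex fps" where
  "formal_word q w f = foldr (formal_letter q) (letters w) f"

definition formal_action :: "real \<Rightarrow> sphere_gen free_star \<Rightarrow> complex fps \<Rightarrow> complex fps" where
  "formal_action q p f =
     (\<Sum>w\<in>Poly_Mapping.keys p. fps_const (Poly_Mapping.lookup p w) * formal_word q w f)"

lemma formal_letter_add: "formal_letter q x (f + g) = formal_letter q x f + formal_letter q x g"
  by (cases "(q, x, f)" rule: formal_letter.cases) (auto simp: fps_eq_iff algebra_simps)

lemma formal_letter_scale: "formal_letter q x (fps_const c * f) = fps_const c * formal_letter q x f"
  by (cases "(q, x, f)" rule: formal_letter.cases) (auto simp: fps_eq_iff algebra_simps)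

lemma formal_word_add: "formal_word q w (f + g) = formal_word q w f + formal_word q w g"
proof -
  have "foldr (formal_letter q) xs (f + g) = foldr (formal_letter q) xs f + foldr (formal_letter q) xs g" for xs
    by (induction xs) (simp_all add: formal_letter_add)
  then show ?thesis by (simp add: formal_word_def)
qed

lemma formal_word_scale: "formal_word q w (fps_const c * f) = fps_const c * formal_word q w f"
proof -
  have "foldr (formal_letter q) xs (fps_const c * f) = fps_const c * foldr (formal_letter q) xs f" for xs
    by (induction xs) (simp_all add: formal_letter_scale)
  then show ?thesis by (simp add: formal_word_def)
qed

lemma formal_action_superset:
  assumes "finite S" "Poly_Mapping.keys p \<subseteq> S"
  shows "formal_action q p f = (\<Sum>w\<in>S. fps_const (Poly_Mapping.lookup p w) * formal_word q w f)"
  unfolding formal_action_def using assms by (intro sum.mono_neutral_left) (auto simp: in_keys_iff)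

lemma formal_action_plus: "formal_action q (p + r) f = formal_action q p f + formal_action q r f"
proof -
  let ?S = "Poly_Mapping.keys p \<union> Poly_Mapping.keys r"
  have "Poly_Mapping.keys (p + r) \<subseteq> ?S" by (rule Poly_Mapping.keys_add)
  then show ?thesis
    using formal_action_superset[of ?S p] formal_action_superset[of ?S r] formal_action_superset[of ?S "p + r"]
    by (simp add: lookup_add sum.distrib distrib_right flip: fps_const_add)
qed

lemma formal_action_single: "formal_action q (Poly_Mapping.single w c) f = fps_const c * formal_word q w f"
  by (cases "c = 0") (simp_all add: formal_action_def)

lemma formal_action_add: "formal_action q p (f + g) = formal_action q p f + formal_action q p g"
  by (simp add: formal_action_def formal_word_add sum.distrib distrib_left)

lemma formal_action_scale: "formal_action q p (fps_const c * f) = fps_const c * formal_action q p f"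
  by (simp add: formal_action_def formal_word_scale sum_distrib_left mult.left_commute)

lemma formal_action_scl: "formal_action q (scl c p) f = fps_const c * formal_action q p f"
  by (induction p rule: poly_mapping_single_induct)
    (simp_all add: formal_action_single formal_action_plus scl_add distrib_left mult.assoc flip: fps_const_mult)

lemma formal_action_zero: "formal_action q 0 f = 0"
  by (simp add: formal_action_def)

lemma formal_action_uminus: "formal_action q (- p) f = - formal_action q p f"
  using formal_action_plus[of q p "- p" f] by (simp add: formal_action_zero eq_neg_iff_add_eq_0 add.commute)

lemma formal_action_diff: "formal_action q (p - r) f = formal_action q p f - formal_action q r f"
  using formal_action_plus[of q p "- r" f] by (simp add: formal_action_uminus)

lemma formal_action_one: "formal_action q 1 f = f"
  using formal_action_single[of q 0 1 f] by (simp add: formal_word_def) (simp add: zero_free_monoid_def)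

lemma formal_action_mult: "formal_action q (p * r) f = formal_action q p (formal_action q r f)"
proof (induction p rule: poly_mapping_single_induct)
  case (single w c)
  show ?case
  proof (induction r rule: poly_mapping_single_induct)
    case (single v d)
    show ?case
      by (simp add: mult_single formal_action_single formal_word_scale)
        (simp add: formal_word_def plus_free_monoid_def mult.assoc flip: fps_const_mult)
  qed (simp add: distrib_left formal_action_plus formal_action_add)
qed (simp add: distrib_right formal_action_plus)

lemma formal_action_gens:
  "formal_action q genK f = Abs_fps (\<lambda>n. of_real (q ^ (2 * n)) * fps_nth f n)"
  "formal_action q (free_star genK) f = Abs_fps (\<lambda>n. of_real (q ^ (2 * n)) * fps_nth f n)"
  "formal_action q genL f = Abs_fps (\<lambda>n. of_real (1 - q ^ (4 * (n + 1))) * fps_nth f (n + 1))"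
  "formal_action q genL' f = fps_X * f"
  by (simp_all add: gen_def free_star_single word_star_def formal_action_single formal_word_def)

text \<open>The annihilator of the action is a two-sided ideal, so only the relations and their adjoints are
  to be checked.\<close>

lemma formal_action_podles_ideal:
  assumes "p \<in> podles_ideal q"
  shows "formal_action q p f = 0"
proof -
  let ?J = "{p. \<forall>f. formal_action q p f = 0}"
  have zero: "formal_action q p 0 = 0" for p
    using formal_action_scale[of q p 0 0] by simp
  have "ideal ?J free_star_algebra"
    by (intro ideal_free_star_algebraI)
      (simp_all add: formal_action_zero formal_action_plus formal_action_uminus formal_action_mult zero)
  moreover have "podles_relations q \<union> free_star ` podles_relations q \<subseteq> ?J"
  proof -
    note minus = free_star_add[of _ "- _", unfolded add_uminus_conv_diff free_star_uminus]
    have one: "free_star 1 = (1 :: sphere_gen free_star)"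
      using free_star_mult[of "free_star 1" 1] by simp
    \<comment> \<open>hides that \<open>c\<close> is a square, so that the relations become polynomial identities in \<open>c\<close> and \<open>c\<^sup>n\<close>\<close>
    define c where "c = (complex_of_real q)\<^sup>2"
    have real: "cnj c = c"
      by (simp add: c_def)
    have q4: "complex_of_real q ^ 4 = c * c"
      by (simp add: c_def flip: power_add)
    have even_power: "complex_of_real q ^ (2 * n) = c ^ n" for n
      by (simp add: c_def power_mult)
    have power_4: "complex_of_real q ^ (4 * n) = c ^ n * c ^ n" for n
      by (simp flip: even_power power_add)
    have nth:
      "fps_nth (formal_action q genK f) n = c ^ n * fps_nth f n"
      "fps_nth (formal_action q (free_star genK) f) n = c ^ n * fps_nth f n"
      "fps_nth (formal_action q genL f) n = (1 - c ^ (n + 1) * c ^ (n + 1)) * fps_nth f (n + 1)"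
      "fps_nth (formal_action q genL' f) n = (case n of 0 \<Rightarrow> 0 | Suc n \<Rightarrow> fps_nth f n)" for f n
      by (simp_all add: formal_action_gens add: even_power power_4 del: mult_Suc_right split: nat.split)
    have "formal_action q p f = 0 \<and> formal_action q (free_star p) f = 0" if "p \<in> podles_relations q" for p f
      using that unfolding podles_relations_def Let_def
      by (elim insertE emptyE; simp only: minus free_star_add free_star_mult free_star_scl
          free_star_free_star one formal_action_diff formal_action_plus formal_action_scl
          formal_action_mult formal_action_one)
        (auto simp: fps_eq_iff nth q4 real algebra_simps simp flip: c_def split: nat.split)
    then show ?thesis by auto
  qed
  ultimately have "podles_ideal q \<subseteq> ?J"
    unfolding podles_ideal_def[of q] by (metis free_alg.genideal_minimal)
  with assms show ?thesis by auto
qed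

text \<open>The action depends only on the class, so any representative will do.\<close>

definition quotient_action :: "real \<Rightarrow> sphere_gen free_star set \<Rightarrow> complex fps \<Rightarrow> complex fps" where
  "quotient_action q X = formal_action q (SOME p. podles_class q p = X)"

lemma quotient_action_class: "quotient_action q (podles_class q p) = formal_action q p"
proof
  fix f
  have "podles_class q (SOME r. podles_class q r = podles_class q p) = podles_class q p"
    by (rule someI) simp
  then show "quotient_action q (podles_class q p) f = formal_action q p f"
    using formal_action_podles_ideal[of "_ - p" q f]
    by (simp add: quotient_action_def podles_class_eq_iff formal_action_diff)
qed

lemma q_power_neq_one:
  fixes q :: real
  assumes "\<bar>q\<bar> < 1" "k > 0"
  shows "q ^ (4 * k) \<noteq> 1"
proof -
  have "\<bar>q\<bar> ^ (4 * k) < 1"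
    using assms by (simp add: power_less_one_iff)
  then show ?thesis by (metis abs_one less_irrefl power_abs)
qed

lemma RP_shift_action_quotient_action:
  assumes "0 < \<bar>q\<bar>" "\<bar>q\<bar> < 1"
  shows "RP_shift_action (\<lambda>c f. fps_const c * f) q (quotient_action q) (\<lambda>k. fps_X ^ k) (\<lambda>m f. fps_nth f m)"
proof -
  let ?sc = "\<lambda>c f :: complex fps. fps_const c * f" and ?e = "\<lambda>k. fps_X ^ k :: complex fps"
  interpret vector_space ?sc
    by standard (simp_all add: algebra_simps flip: fps_const_add fps_const_mult)
  have K: "formal_action q genK (?e k) = ?sc (of_real (q ^ (2 * k))) (?e k)" for k
    by (auto simp: formal_action_gens fps_eq_iff)
  have K_shift: "weighted_shift ?sc ?e 0 (formal_action q genK)"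
    unfolding weighted_shift_def using assms
    by (intro exI[of _ "\<lambda>k. of_real (q ^ (2 * k))"]) (simp add: K)
  have L_shift: "weighted_shift ?sc ?e 1 (formal_action q genL)"
  proof -
    note neq = q_power_neq_one[OF assms(2)]
    have pos: "formal_action q genL (?e k) = ?sc (of_real (1 - q ^ (4 * k))) (?e (k - 1))" if "k > 0" for k
      using that by (auto simp: formal_action_gens fps_eq_iff)
    have zero: "formal_action q genL (?e 0) = 0"
      by (auto simp: formal_action_gens fps_eq_iff)
    have "if 1 \<le> int k then complex_of_real (1 - q ^ (4 * k)) \<noteq> 0 \<and>
        formal_action q genL (?e k) = ?sc (of_real (1 - q ^ (4 * k))) (?e (nat (int k - 1)))
      else formal_action q genL (?e k) = 0" for k
    proof (cases "k = 0")
      case False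
      then have "nat (int k - 1) = k - 1" by simp
      with False neq[of k] pos[of k] show ?thesis
        by (simp del: of_real_diff of_real_power of_real_mult)
    qed (use zero in simp)
    then show ?thesis
      unfolding weighted_shift_def by (intro exI[of _ "\<lambda>k. of_real (1 - q ^ (4 * k))"]) blast
  qed
  have L'_shift: "weighted_shift ?sc ?e (- 1) (formal_action q genL')"
    unfolding weighted_shift_def
    by (intro exI[of _ "\<lambda>_. 1"]) (simp add: formal_action_gens nat_add_distrib)
  have comp: "weighted_shift ?sc ?e (d + d') (formal_action q (p * r))"
    if "weighted_shift ?sc ?e d (formal_action q p)" "weighted_shift ?sc ?e d' (formal_action q r)"
      "d \<ge> 0 \<or> d' \<le> 0" for d d' p r
  proof -
    have "formal_action q (p * r) = (\<lambda>f. formal_action q p (formal_action q r f))"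
      by (rule ext) (rule formal_action_mult)
    moreover have "formal_action q p (?sc c f) = ?sc c (formal_action q p f)" for c f
      by (rule formal_action_scale)
    ultimately show ?thesis
      using weighted_shift_comp[where sc = ?sc and e = ?e and A = "formal_action q p"
          and B = "formal_action q r" and d = d and d' = d'] vector_space_axioms that
      by simp
  qed
  show ?thesis
  proof unfold_locales
    fix a b x
    assume "a \<in> carrier (RP q)" "b \<in> carrier (RP q)"
    then obtain p r where ab: "a = podles_class q p" "b = podles_class q r"
      by (auto simp: RP_def carrier_podles)
    show "quotient_action q (a \<oplus>\<^bsub>RP q\<^esub> b) x = quotient_action q a x + quotient_action q b x"
      "quotient_action q (a \<otimes>\<^bsub>RP q\<^esub> b) x = quotient_action q a (quotient_action q b x)"
      by (simp_all add: ab podles_class_ops quotient_action_class formal_action_plus formal_action_mult)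
  next
    fix a c x
    assume "a \<in> carrier (RP q)"
    then obtain p where a: "a = podles_class q p"
      by (auto simp: RP_def carrier_podles)
    show "quotient_action q (c \<odot>\<^bsub>RP q\<^esub> a) x = fps_const c * quotient_action q a x"
      "quotient_action q a (fps_const c * x) = fps_const c * quotient_action q a x"
      by (simp_all add: a podles_class_ops quotient_action_class formal_action_scl formal_action_scale)
  next
    fix k
    have "q ^ (4 * k) = q ^ (2 * k) * q ^ (2 * k)"
      by (simp flip: power_add)
    then show "quotient_action q (RP_P q) (fps_X ^ k) = fps_const (of_real (q ^ (4 * k))) * fps_X ^ k"
      unfolding RP_gens_class quotient_action_class power2_eq_square formal_action_mult K formal_action_scale
      by (simp flip: fps_const_mult mult.assoc)
  next
    show "weighted_shift ?sc ?e 2 (quotient_action q (RP_R q))"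
      unfolding RP_gens_class quotient_action_class power2_eq_square
      using comp[OF L_shift L_shift] by simp
    show "weighted_shift ?sc ?e (- 2) (quotient_action q (star (RP q) (RP_R q)))"
      unfolding RP_gens_class(4) quotient_action_class power2_eq_square
      using comp[OF L'_shift L'_shift] by simp
    show "weighted_shift ?sc ?e 1 (quotient_action q (RP_T q))"
      unfolding RP_gens_class quotient_action_class
      using comp[OF K_shift L_shift] by simp
    show "weighted_shift ?sc ?e (- 1) (quotient_action q (star (RP q) (RP_T q)))"
      unfolding RP_gens_class(5) quotient_action_class
      using comp[OF L'_shift K_shift] by simp
    show "quotient_action q \<one>\<^bsub>RP q\<^esub> x = x" for x
      by (simp add: podles_class_ops quotient_action_class formal_action_one)
  qed (use assms in auto)
qed

section \<open>The representation on a Hilbert space\<close>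

lemma cinner_add_left: "cinner (x + y) z = cinner x z + cinner y z"
  by (metis cinner_add_right cinner_commute complex_cnj_add)

lemma cinner_scaleC_left: "cinner (c *\<^sub>C x) y = cnj c * cinner x y"
  by (metis cinner_commute cinner_scaleC_right complex_cnj_mult)

lemma cinner_zero_right: "cinner x 0 = 0"
  using cinner_scaleC_right[of x 0 0] by simp

text \<open>By Pythagoras, a vector orthogonal to a subspace has distance at least its norm from every
  vector of the subspace. As the span of the basis comes arbitrarily close to it, the norm is zero.\<close>

lemma orthogonal_to_basis_eq_zero:
  assumes e: "orthonormal_basis e" and x: "\<And>m. cinner x (e m) = 0"
  shows "x = 0"
proof -
  have orth: "cinner x s = 0" if "s \<in> cvs.span (range e)" for s
    using that
  proof (induction rule: cvs.span_induct_alt)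
    case (step c b y)
    then show ?case using x by (auto simp: cinner_add_right cinner_scaleC_right)
  qed (simp add: cinner_zero_right)
  have "norm x \<le> dist s x" if "s \<in> cvs.span (range e)" for s
  proof -
    define t where "t = - s"
    have t: "t \<in> cvs.span (range e)"
      using that unfolding t_def by (rule cvs.span_neg)
    have "cinner (x + t) (x + t) = cinner x x + cinner t t"
      using orth[OF t] cinner_commute[of t x] by (simp add: cinner_add_left cinner_add_right)
    then have "(norm (x + t))\<^sup>2 = (norm x)\<^sup>2 + (norm t)\<^sup>2"
      by (simp only: cinner_self of_real_eq_iff flip: of_real_add)
    then have "(norm x)\<^sup>2 \<le> (norm (x + t))\<^sup>2"
      by simp
    then have "norm x \<le> norm (x + t)"
      by (rule power2_le_imp_le) simp
    then show ?thesis
      by (simp add: dist_norm norm_minus_commute t_def)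
  qed
  moreover have "x \<in> closure (cvs.span (range e))"
    using e by (simp add: orthonormal_basis_def)
  ultimately have "norm x < \<epsilon> \<or> norm x = 0" if "\<epsilon> > 0" for \<epsilon>
    using that unfolding closure_approachable by (meson le_less_trans)
  from this[of "norm x"] show ?thesis by auto
qed

text \<open>A star-representation is given here by its values on \<open>P\<close>, \<open>R\<close>, \<open>T\<close>; the action of \<open>R\<^sup>*\<close> and \<open>T\<^sup>*\<close> on
  the basis is recovered from the adjoints.\<close>

lemma weighted_shift_adjoint:
  assumes e: "orthonormal_basis e" and A: "weighted_shift (*\<^sub>C) e d A"
    and adj: "\<And>x y. cinner (A' x) y = cinner x (A y)"
  shows "weighted_shift (*\<^sub>C) e (- d) A'"
proof -
  have ee: "cinner (e i) (e j) = (if i = j then 1 else 0)" for i j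
    using e by (simp add: orthonormal_basis_def)
  obtain s where s: "\<And>k. if d \<le> int k then s k \<noteq> 0 \<and> A (e k) = s k *\<^sub>C e (nat (int k - d)) else A (e k) = 0"
    using A unfolding weighted_shift_def by auto
  have coeff: "cinner (A' (e k)) (e m) = (if int m = int k + d then s m else 0)" for k m
  proof (cases "d \<le> int m")
    case True
    then have "k = nat (int m - d) \<longleftrightarrow> int m = int k + d" by auto
    then show ?thesis
      using True s[of m] by (simp add: adj cinner_scaleC_right ee)
  next
    case False
    then show ?thesis using s[of m] by (simp add: adj cinner_zero_right)
  qed
  have "if - d \<le> int k then cnj (s (nat (int k + d))) \<noteq> 0 \<and>
      A' (e k) = cnj (s (nat (int k + d))) *\<^sub>C e (nat (int k - - d)) else A' (e k) = 0" for k
  proof (cases "- d \<le> int k")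
    case True
    let ?j = "nat (int k + d)"
    have "A' (e k) + (- cnj (s ?j)) *\<^sub>C e ?j = 0"
    proof (rule orthogonal_to_basis_eq_zero[OF e])
      fix m
      have "int m = int k + d \<longleftrightarrow> ?j = m" using True by auto
      then show "cinner (A' (e k) + (- cnj (s ?j)) *\<^sub>C e ?j) (e m) = 0"
        by (auto simp: cinner_add_left cinner_scaleC_left ee coeff simp del: cvs.scale_minus_left)
    qed
    moreover have "s ?j \<noteq> 0"
      using s[of ?j] True by simp
    ultimately show ?thesis
      using True by (simp add: add_eq_0_iff2)
  next
    case False
    have "A' (e k) = 0"
      by (rule orthogonal_to_basis_eq_zero[OF e]) (use False in \<open>simp add: coeff\<close>)
    with False show ?thesis by simp
  qed
  then show ?thesis
    unfolding weighted_shift_def by (intro exI[of _ "\<lambda>k. cnj (s (nat (int k + d)))"]) blast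
qed

lemma RP_shift_action_star_rep:
  fixes e :: "nat \<Rightarrow> 'h::chilbert_space"
  assumes q: "0 < \<bar>q\<bar>" "\<bar>q\<bar> < 1" and e: "orthonormal_basis e" and rep: "star_rep (RP q) \<rho>"
    and P: "\<And>k. \<rho> (RP_P q) (e k) = complex_of_real (q^(4*k)) *\<^sub>C e k"
    and T: "\<And>k. \<rho> (RP_T q) (e k) = (if k = 0 then 0
      else complex_of_real (q^(2*(k-1)) * sqrt (1 - q^(4*k))) *\<^sub>C e (k-1))"
    and R: "\<And>k. \<rho> (RP_R q) (e k) = (if k < 2 then 0
      else complex_of_real (sqrt ((1 - q^(4*k)) * (1 - q^(4*(k-1))))) *\<^sub>C e (k-2))"
  shows "RP_shift_action (*\<^sub>C) q \<rho> e (\<lambda>m x. cinner (e m) x)"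
proof -
  note pos = q_power_neq_one[OF q(2)]
  have T_shift: "weighted_shift (*\<^sub>C) e 1 (\<rho> (RP_T q))"
  proof -
    have "if 1 \<le> int k then complex_of_real (q^(2*(k-1)) * sqrt (1 - q^(4*k))) \<noteq> 0 \<and>
        \<rho> (RP_T q) (e k) = complex_of_real (q^(2*(k-1)) * sqrt (1 - q^(4*k))) *\<^sub>C e (nat (int k - 1))
      else \<rho> (RP_T q) (e k) = 0" for k
    proof (cases "k = 0")
      case False
      then have "nat (int k - 1) = k - 1" by simp
      with False pos[of k] T[of k] q show ?thesis
        by (simp del: of_real_mult of_real_power)
    qed (simp add: T)
    then show ?thesis
      unfolding weighted_shift_def
      by (intro exI[of _ "\<lambda>k. complex_of_real (q^(2*(k-1)) * sqrt (1 - q^(4*k)))"]) blast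
  qed
  have R_shift: "weighted_shift (*\<^sub>C) e 2 (\<rho> (RP_R q))"
  proof -
    let ?s = "\<lambda>k. complex_of_real (sqrt ((1 - q^(4*k)) * (1 - q^(4*(k-1)))))"
    have "if 2 \<le> int k then ?s k \<noteq> 0 \<and> \<rho> (RP_R q) (e k) = ?s k *\<^sub>C e (nat (int k - 2))
      else \<rho> (RP_R q) (e k) = 0" for k
    proof (cases "k < 2")
      case False
      then have "nat (int k - 2) = k - 2" by simp
      moreover have "q ^ (4 * k) \<noteq> 1" "q ^ (4 * (k - 1)) \<noteq> 1"
        using False by (intro pos; simp)+
      then have "?s k \<noteq> 0" by simp
      ultimately show ?thesis
        using False R[of k] by simp
    qed (simp add: R)
    then show ?thesis
      unfolding weighted_shift_def by (intro exI[of _ ?s]) blast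
  qed
  have adj: "cinner (\<rho> (star (RP q) a) x) y = cinner x (\<rho> a y)" if "a \<in> carrier (RP q)" for a x y
    using rep that unfolding star_rep_def by blast
  show ?thesis
  proof (intro RP_shift_action.intro RP_shift_action_axioms.intro cvs.vector_space_axioms)
    show "weighted_shift (*\<^sub>C) e (- 2) (\<rho> (star (RP q) (RP_R q)))"
      using e R_shift adj[OF RP_gens_in_carrier(2)] by (rule weighted_shift_adjoint)
    show "weighted_shift (*\<^sub>C) e (- 1) (\<rho> (star (RP q) (RP_T q)))"
      using e T_shift adj[OF RP_gens_in_carrier(3)] by (rule weighted_shift_adjoint)
    show "cinner (e m) (e k) = (if m = k then 1 else 0)" for m k
      using e by (simp add: orthonormal_basis_def)
    show "0 < \<bar>q\<bar>" "\<bar>q\<bar> < 1" by fact+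
    show "\<rho> (RP_P q) (e k) = complex_of_real (q ^ (4 * k)) *\<^sub>C e k" for k by (rule P)
  qed (use rep in \<open>auto simp: star_rep_def bounded_clinear_def cinner_add_right cinner_scaleC_right
         simp del: RP_ops intro: T_shift R_shift\<close>)
qed

section \<open>Basis and faithfulness\<close>

text \<open>The difference of two elements with the same action is a combination of monomials that acts as
  zero, so its coefficients vanish.\<close>

lemma (in RP_shift_action) inj_on_act: "inj_on act (carrier (RP q))"
proof (rule inj_onI)
  interpret V: vectorspace class_ring "RP q"
    by (rule vectorspace_RP)
  fix x y assume xy: "x \<in> carrier (RP q)" "y \<in> carrier (RP q)" "act x = act y"
  define z where "z = x \<oplus>\<^bsub>RP q\<^esub> ((- 1) \<odot>\<^bsub>RP q\<^esub> y)"
  have y: "(- 1) \<odot>\<^bsub>RP q\<^esub> y \<in> carrier (RP q)"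
    using V.smult_closed[of "- 1" y] xy(2) by simp
  then have "z \<in> carrier (RP q)"
    unfolding z_def using xy(1) by (rule V.M.a_closed[rotated])
  moreover have "q \<noteq> 0" using q by simp
  ultimately obtain a A where A: "finite A" "A \<subseteq> range (RP_monomial q)" "z = V.lincomb a A"
    unfolding span_RP_monomial[OF \<open>q \<noteq> 0\<close>, symmetric] V.span_def by blast
  have "act z f = 0" for f
    unfolding z_def using act_add[OF xy(1) y] act_smult[OF xy(2)] xy(3) by simp
  then have coeff: "a v = 0" if "v \<in> A" for v
    using lincomb_RP_monomial_annihilating[OF A(1,2)] A(3) that by simp
  have AC: "A \<subseteq> carrier (RP q)"
    using A(2) RP_monomial_closed by auto
  then have "V.lincomb a A = V.lincomb (\<lambda>_. 0) A"
    using coeff by (intro V.lincomb_cong) auto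
  also have "\<dots> = \<zero>\<^bsub>RP q\<^esub>"
    unfolding V.lincomb_def using AC V.lmult_0 by (intro V.M.finsum_all0) auto
  finally have z: "z = \<zero>\<^bsub>RP q\<^esub>"
    using A(3) by simp
  obtain p r where "x = podles_class q p" "y = podles_class q r"
    using xy by (auto simp: RP_def carrier_podles)
  with z show "x = y"
    by (simp add: z_def podles_class_ops podles_class_eq_iff)
qed

lemma basis_RP_monomial:
  assumes "0 < \<bar>q\<bar>" "\<bar>q\<bar> < 1"
  shows "vectorspace.basis class_ring (RP q) (range (RP_monomial q))"
proof -
  interpret V: vectorspace class_ring "RP q"
    by (rule vectorspace_RP)
  interpret F: RP_shift_action "\<lambda>c f. fps_const c * f" q "quotient_action q" "\<lambda>k. fps_X ^ k" "\<lambda>m f. fps_nth f m"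
    using assms by (rule RP_shift_action_quotient_action)
  have act_zero: "quotient_action q \<zero>\<^bsub>RP q\<^esub> f = 0" for f
    by (simp add: podles_class_ops quotient_action_class formal_action_zero)
  have "V.lin_indpt (range (RP_monomial q))"
    unfolding V.lin_dep_def using F.lincomb_RP_monomial_annihilating act_zero by auto
  moreover have "q \<noteq> 0" using assms by simp
  ultimately show ?thesis
    unfolding V.basis_def using span_RP_monomial RP_monomial_closed by blast
qed

theorem proposition1:
  fixes q :: real
  assumes "0 < \<bar>q\<bar>" and "\<bar>q\<bar> < 1"
  shows "(\<forall>(e :: nat \<Rightarrow> 'h::chilbert_space) \<rho>.
            orthonormal_basis e \<and> star_rep (RP q) \<rho> \<and>
            (\<forall>k. \<rho> (RP_P q) (e k) = complex_of_real (q^(4*k)) *\<^sub>C e k) \<and>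
            (\<forall>k. \<rho> (RP_T q) (e k) =
               (if k = 0 then 0
                else complex_of_real (q^(2*(k-1)) * sqrt (1 - q^(4*k))) *\<^sub>C e (k-1))) \<and>
            (\<forall>k. \<rho> (RP_R q) (e k) =
               (if k < 2 then 0
                else complex_of_real (sqrt ((1 - q^(4*k)) * (1 - q^(4*(k-1))))) *\<^sub>C e (k-2)))
            \<longrightarrow> inj_on \<rho> (carrier (RP q)))
       \<and> vectorspace.basis class_ring (RP q)
           ({RP_P q [^]\<^bsub>RP q\<^esub> k \<otimes>\<^bsub>RP q\<^esub> RP_R q [^]\<^bsub>RP q\<^esub> l | (k :: nat) (l :: nat). True}
            \<union> {RP_P q [^]\<^bsub>RP q\<^esub> k \<otimes>\<^bsub>RP q\<^esub> star (RP q) (RP_R q) [^]\<^bsub>RP q\<^esub> l | (k :: nat) (l :: nat). l \<noteq> 0}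
            \<union> {RP_P q [^]\<^bsub>RP q\<^esub> k \<otimes>\<^bsub>RP q\<^esub> RP_R q [^]\<^bsub>RP q\<^esub> l \<otimes>\<^bsub>RP q\<^esub> RP_T q | (k :: nat) (l :: nat). True}
            \<union> {RP_P q [^]\<^bsub>RP q\<^esub> k \<otimes>\<^bsub>RP q\<^esub> star (RP q) (RP_R q) [^]\<^bsub>RP q\<^esub> l
                 \<otimes>\<^bsub>RP q\<^esub> star (RP q) (RP_T q) | (k :: nat) (l :: nat). True})"
proof (intro conjI allI impI; (elim conjE)?)
  fix e :: "nat \<Rightarrow> 'h" and \<rho>
  assume "orthonormal_basis e" "star_rep (RP q) \<rho>"
    "\<forall>k. \<rho> (RP_P q) (e k) = complex_of_real (q^(4*k)) *\<^sub>C e k"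
    "\<forall>k. \<rho> (RP_T q) (e k) = (if k = 0 then 0
      else complex_of_real (q^(2*(k-1)) * sqrt (1 - q^(4*k))) *\<^sub>C e (k-1))"
    "\<forall>k. \<rho> (RP_R q) (e k) = (if k < 2 then 0
      else complex_of_real (sqrt ((1 - q^(4*k)) * (1 - q^(4*(k-1))))) *\<^sub>C e (k-2))"
  then interpret RP_shift_action "(*\<^sub>C)" q \<rho> e "\<lambda>m x. cinner (e m) x"
    using assms by (intro RP_shift_action_star_rep) auto
  show "inj_on \<rho> (carrier (RP q))"
    by (rule inj_on_act)
qed (use basis_RP_monomial[OF assms] in \<open>simp only: range_RP_monomial\<close>)

end
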